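(* Let $\mu_0$ be a probability measure on $\mathscr{B}(\mathbb{R})$ with Fourier–Stieltjes transform $\phi_0$, and let $\mu(\cdot,t)$ be the probability measure whose Fourier–Stieltjes transform is the solution $\phi(\cdot,t)$ of the Kac equation with initial datum $\phi_0$. For each $t>0$ there are a probability space $(\Omega,\mathscr{F},P_t)$ and random variables $$\tilde\nu_t:\Omega\to\mathbb{N},\qquad \tilde\gamma:\Omega\to G:=\bigcup_{n\ge1}G(n),\qquad \tilde\theta=(\tilde\theta_1,\tilde\theta_2,\dots):\Omega\to[0,2\pi)^\infty,\qquad \tilde x=(\tilde x_1,\tilde x_2,\dots):\Omega\to\mathbb{R}^\infty$$ with joint distribution $$P_t\{\tilde\nu_t=n,\ \tilde\gamma=\gamma,\ \tilde\theta\in A,\ \tilde x\in B\}=q_t(n)\,p_n(\gamma)\,\mathbb{1}_{G(n)}(\gamma)\,u^\infty(A)\,\mu_0^\infty(B)$$ for all $n\in\mathbb{N}=\{1,2,\dots\}$, $\gamma\in G$, $A\in\mathscr{B}([0,2\pi)^\infty)$, $B\in\mathscr{B}(\mathbb{R}^\infty)$, such that the random variable $$V_t:=\sum_{j=1}^{\tilde\nu_t}\pi_j(\tilde\gamma,\tilde\theta)\,\tilde x_j$$ has probability distribution $\mu(\cdot,t)$.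
   Context: $\mathscr{B}(\cdot)$ denotes Borel $\sigma$-algebras. The Fourier–Stieltjes transform of a probability measure $\mu$ on $\mathscr{B}(\mathbb{R})$ is $\xi\mapsto\int_{\mathbb{R}}e^{i\xi x}\mu(dx)$. Kac equation (Fourier form): $$\frac{\partial}{\partial t}\phi(\xi,t)=\frac1{2\pi}\int_0^{2\pi}\phi(\xi\sin\theta,t)\,\phi(\xi\cos\theta,t)\,d\theta-\phi(\xi,t)\quad(t>0,\ \xi\in\mathbb{R}),\qquad \phi(\xi,0)=\phi_0(\xi).$$ It is known that there is exactly one solution such that, for each $t\ge0$, $\phi(\cdot,t)$ is the Fourier–Stieltjes transform of a probability measure $\mu(\cdot,t)$; it is given by the Wild series $\phi(\xi,t)=\sum_{n\ge1}e^{-t}(1-e^{-t})^{n-1}\hat q_n^+(\xi;\phi_0)$, where $\hat q_1^+=\phi_0$, $\hat q_n^+=\frac1{n-1}\sum_{j=1}^{n-1}\hat q_{n-j}^+\circ\hat q_j^+$ for $n\ge2$, and $(g_1\circ g_2)(\xi)=\frac1{2\pi}\int_0^{2\pi}g_1(\xi\cos\theta)g_2(\xi\sin\theta)\,d\theta$ (Wild product). Weights: $q_t(n):=e^{-t}(1-e^{-t})^{n-1}$, $n=1,2,\dots$. $u^\infty$ is the probability measure on $\mathscr{B}([0,2\pi)^\infty)$ making the coordinates i.i.d. uniform on $[0,2\pi)$; $\mu_0^\infty$ is the probability measure on $\mathscr{B}(\mathbb{R}^\infty)$ making the coordinates i.i.d. with law $\mu_0$. Trees: $G(n)$ is the (finite)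 set of McKean trees with $n$ leaves, i.e. rooted plane binary trees in which every vertex has either no children (a leaf) or exactly two, a left child and a right child. A tree in $G(n)$ has $n-1$ internal vertices, called nodes; $G(1)$ consists of the single-vertex tree. $p_n$ is the probability on $G(n)$ determined by $p_1=1$ and, for $n\ge2$, $p_n(\gamma)=\frac1{n-1}p_{n-j}(\gamma_l)\,p_j(\gamma_r)$ if the left subtree $\gamma_l$ of the root has $n-j$ leaves and the right subtree $\gamma_r$ has $j$ leaves. Coefficients: in each $\gamma\in G(n)$ fix an order on the $n-1$ nodes and associate $\theta_k$ with the $k$-th node; number the leaves $1,\dots,n$ from left to right. For leaf $j$, $\pi_j(\gamma,\theta)$ is the product, over all edges of the path joining leaf $j$ to the root, of the factor $\cos\theta_k$ if the lower vertex of the edge is the left child, or $\sin\theta_k$ if it is the right child, of the upper vertex, where the upper vertex is the $k$-th node. For $n=1$, $\pi_1\equiv1$. *)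

theory Defs
  imports "HOL-Probability.Probability"
begin

text \<open>The differential equation is only required for positive times, so the initial datum is
  attached to it by right-continuity at time 0; without this the value at time 0 would be
  unrelated to the later evolution and solutions would not be unique.\<close>

definition kac_solution :: "(real \<Rightarrow> complex) \<Rightarrow> (real \<Rightarrow> real \<Rightarrow> complex) \<Rightarrow> bool" where
  "kac_solution \<phi>\<^sub>0 \<phi> \<longleftrightarrow>
     (\<forall>\<xi>. \<phi> \<xi> 0 = \<phi>\<^sub>0 \<xi> \<and> (\<phi> \<xi> \<longlongrightarrow> \<phi>\<^sub>0 \<xi>) (at_right 0) \<and>
       (\<forall>t>0. (\<phi> \<xi> has_vector_derivative
          complex_of_real (1 / (2 * pi)) *
            (LBINT \<theta>:{0..2 * pi}. \<phi> (\<xi> * sin \<theta>) t * \<phi> (\<xi> * cos \<theta>) t) - \<phi> \<xi> t) (at t)))"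

datatype mckean = Leaf | Node mckean mckean

fun leaves :: "mckean \<Rightarrow> nat" where
  "leaves Leaf = 1"
| "leaves (Node l r) = leaves l + leaves r"

definition G :: "nat \<Rightarrow> mckean set" where
  "G n = {\<gamma>. leaves \<gamma> = n}"

text \<open>A tree determines its number of leaves, so the family of probabilities \<open>p\<^sub>n\<close> on \<open>G n\<close> is
  given by a single function on all trees.\<close>

fun tree_prob :: "mckean \<Rightarrow> real" where
  "tree_prob Leaf = 1"
| "tree_prob (Node l r) = 1 / (real (leaves (Node l r)) - 1) * tree_prob l * tree_prob r"

text \<open>A vertex is represented by the sequence of steps leading to it from the root.\<close>

datatype child = LeftChild | RightChild

fun nodes :: "mckean \<Rightarrow> child list set" where
  "nodes Leaf = {}"
| "nodes (Node l r) = insert [] ((#) LeftChild ` nodes l \<union> (#) RightChild ` nodes r)"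

fun leaf_paths :: "mckean \<Rightarrow> child list list" where
  "leaf_paths Leaf = [[]]"
| "leaf_paths (Node l r) = map ((#) LeftChild) (leaf_paths l) @ map ((#) RightChild) (leaf_paths r)"

text \<open>Nodes, leaves and the entries of sequences are numbered from 0 instead of 1. An ordering of
  the nodes is chosen separately in every tree.\<close>

definition node_order :: "(mckean \<Rightarrow> child list \<Rightarrow> nat) \<Rightarrow> bool" where
  "node_order ord \<longleftrightarrow> (\<forall>\<gamma>. bij_betw (ord \<gamma>) (nodes \<gamma>) {..<leaves \<gamma> - 1})"

fun edge_factor :: "child \<Rightarrow> real \<Rightarrow> real" where
  "edge_factor LeftChild \<theta> = cos \<theta>"
| "edge_factor RightChild \<theta> = sin \<theta>"

text \<open>The \<open>i\<close>-th edge below the root on a path \<open>p\<close> leads from the vertex \<open>take i p\<close> to its child in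
  direction \<open>p ! i\<close>. The value is meaningful for \<open>j < leaves \<gamma>\<close> only.\<close>

definition leaf_coeff ::
    "(mckean \<Rightarrow> child list \<Rightarrow> nat) \<Rightarrow> nat \<Rightarrow> mckean \<Rightarrow> (nat \<Rightarrow> real) \<Rightarrow> real" where
  "leaf_coeff ord j \<gamma> \<theta> =
     (let p = leaf_paths \<gamma> ! j
      in \<Prod>i<length p. edge_factor (p ! i) (\<theta> (ord \<gamma> (take i p))))"

definition wild_weight :: "real \<Rightarrow> nat \<Rightarrow> real" where
  "wild_weight t n = exp (-t) * (1 - exp (-t)) ^ (n - 1)"

definition uniform_angle :: "real measure" where
  "uniform_angle = uniform_measure (restrict_space lborel {0..<2 * pi}) {0..<2 * pi}"

text \<open>The underlying spaces of these two measures are the sequences in \<open>{0..<2 * pi}\<close> and all real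
  sequences. As the index set is countable and the factors are second countable, the product
  sigma-algebras are the Borel sigma-algebras of the product topologies
  (cf. \<open>sets_PiM_equal_borel\<close>).\<close>

abbreviation angle_seq :: "(nat \<Rightarrow> real) measure" where
  "angle_seq \<equiv> PiM UNIV (\<lambda>_. uniform_angle)"

abbreviation iid_seq :: "real measure \<Rightarrow> (nat \<Rightarrow> real) measure" where
  "iid_seq \<mu>\<^sub>0 \<equiv> PiM UNIV (\<lambda>_. \<mu>\<^sub>0)"

end

theory Submission
  imports Defs
begin

text \<open>The characteristic functions of the laws of \<open>V\<close> given the tree are built recursively by Wild
  products, because the two subtrees of the root use disjoint, hence independent, families of angles
  and leaf variables. Averaging over the trees with \<open>n\<close> leaves therefore gives Wild's recursion, so
  that the characteristic function of \<open>V\<close> is the sum of the Wild series. This series solves the Kac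
  equation, and a Gronwall argument shows that bounded solutions are unique; the theorem follows
  from the uniqueness theorem for characteristic functions.\<close>

text \<open>The law \<open>\<mu> t\<close> is known only through a given solution of the Kac
  equation, so computing the law of \<open>V\<close> is half of the work; the other half is to
  identify that solution with the Wild series. Both meet in the coefficients
  \<open>wild_coeff\<close>, which are averages over trees and satisfy Wild's recursion. The
  obstacle on the probabilistic side is that the node order is arbitrary in each tree, and that a
  subtree need not inherit a numbering by an initial segment. The induction over trees therefore
  assumes only an order that is injective on the nodes, and a leaf numbering that may start
  anywhere: since the coordinates are identically distributed, the choice of indices does not affect
  the law, and disjointness of the index sets gives independence.\<close>

section \<open>Uniform angles and Wild products\<close>

text \<open>The same law as \<open>uniform_angle\<close>, but carried by the whole line, so that
  integrals and product measures need no restricted spaces; \<open>distr_uniform_angle\<close> is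
  the link.\<close>

definition angle_law :: "real measure" where
  "angle_law = uniform_measure lborel {0..<2 * pi}"

lemma angle_law_density:
  "angle_law = density lborel (\<lambda>\<theta>. ennreal (indicator {0..<2 * pi} \<theta> / (2 * pi)))"
proof -
  have "indicator {0..<2 * pi} \<theta> / emeasure lborel {0..<2 * pi} =
      ennreal (indicator {0..<2 * pi} \<theta> / (2 * pi))" for \<theta>
    using divide_ennreal[of "indicator {0..<2 * pi} \<theta>" "2 * pi"]
    by (simp add: ennreal_indicator)
  then show ?thesis
    unfolding angle_law_def uniform_measure_def by simp
qed

lemma sets_angle_law [simp, measurable_cong]: "sets angle_law = sets borel"
  by (simp add: angle_law_def)

lemma space_angle_law [simp]: "space angle_law = UNIV"
  by (simp add: angle_law_def)

interpretation angle_law: prob_space angle_law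
  unfolding angle_law_def by (rule prob_space_uniform_measure) auto

lemma sets_uniform_angle: "sets uniform_angle = sets (restrict_space borel {0..<2 * pi})"
  by (simp add: uniform_angle_def sets_restrict_space)

lemma space_uniform_angle: "space uniform_angle = {0..<2 * pi}"
  by (simp add: uniform_angle_def space_restrict_space)

lemma measurable_uniform_angle: "(\<lambda>\<theta>. \<theta>) \<in> uniform_angle \<rightarrow>\<^sub>M borel"
  by (simp add: measurable_cong_sets[OF sets_uniform_angle refl] measurable_restrict_space1)

lemma emeasure_uniform_angle:
  assumes "A \<in> sets uniform_angle"
  shows "emeasure uniform_angle A = emeasure lborel A / ennreal (2 * pi)"
proof -
  have A: "A \<in> sets (restrict_space lborel {0..<2 * pi})"
    using assms by (simp add: uniform_angle_def)
  then have subset: "A \<subseteq> {0..<2 * pi}"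
    by (simp add: sets_restrict_space_iff)
  have emeasure: "emeasure (restrict_space lborel {0..<2 * pi}) B = emeasure lborel B"
    if "B \<subseteq> {0..<2 * pi}" for B
    using that by (intro emeasure_restrict_space) simp_all
  have "{0..<2 * pi} \<in> sets (restrict_space lborel {0..<2 * pi})"
    by (simp add: sets_restrict_space_iff)
  then have "emeasure uniform_angle A = emeasure lborel ({0..<2 * pi} \<inter> A) / emeasure lborel {0..<2 * pi}"
    unfolding uniform_angle_def using A by (simp only: emeasure_uniform_measure emeasure Int_lower1 order_refl)
  then show ?thesis
    using subset by (simp add: Int_absorb1)
qed

lemma prob_space_uniform_angle: "prob_space uniform_angle"
  by (rule prob_spaceI)
     (use sets.top[of uniform_angle] in
       \<open>simp add: emeasure_uniform_angle space_uniform_angle ennreal_divide_self\<close>)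

lemma distr_uniform_angle: "distr uniform_angle borel (\<lambda>\<theta>. \<theta>) = angle_law"
proof (rule measure_eqI)
  fix A :: "real set"
  assume "A \<in> sets (distr uniform_angle borel (\<lambda>\<theta>. \<theta>))"
  then have A: "A \<in> sets borel" by simp
  then have "A \<inter> {0..<2 * pi} \<in> sets uniform_angle"
    by (auto simp: sets_uniform_angle sets_restrict_space)
  then show "emeasure (distr uniform_angle borel (\<lambda>\<theta>. \<theta>)) A = emeasure angle_law A"
    using A by (simp add: measurable_uniform_angle emeasure_distr space_uniform_angle emeasure_uniform_angle angle_law_def
      Int_commute)
qed simp

definition wild_prod :: "(real \<Rightarrow> complex) \<Rightarrow> (real \<Rightarrow> complex) \<Rightarrow> real \<Rightarrow> complex" where
  "wild_prod f g \<xi> = (\<integral>\<theta>. f (\<xi> * cos \<theta>) * g (\<xi> * sin \<theta>) \<partial>angle_law)"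

text \<open>The equation integrates over the closed interval and the angle law lives on the
  half-open one; they differ by a null set. The order of the two factors is exchanged as
  well.\<close>

lemma kac_integral_eq_wild_prod:
  fixes f :: "real \<Rightarrow> complex"
  assumes [measurable]: "f \<in> borel_measurable borel"
  shows "complex_of_real (1 / (2 * pi)) *
    (LBINT \<theta>:{0..2 * pi}. f (\<xi> * sin \<theta>) * f (\<xi> * cos \<theta>)) = wild_prod f f \<xi>"
proof -
  let ?h = "\<lambda>\<theta>. f (\<xi> * cos \<theta>) * f (\<xi> * sin \<theta>)"
  have "wild_prod f f \<xi> =
      (LBINT \<theta>. (indicator {0..<2 * pi} \<theta> / (2 * pi)) *\<^sub>R ?h \<theta>)"
    unfolding wild_prod_def angle_law_density by (subst integral_density) auto
  also have "\<dots> = (LBINT \<theta>. complex_of_real (1 / (2 * pi)) * (indicator {0..2 * pi} \<theta> *\<^sub>R ?h \<theta>))"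
    (is "_ = ?R")
  proof (rule integral_cong_AE)
    show "AE \<theta> in lborel. (indicator {0..<2 * pi} \<theta> / (2 * pi)) *\<^sub>R ?h \<theta> =
        complex_of_real (1 / (2 * pi)) * (indicator {0..2 * pi} \<theta> *\<^sub>R ?h \<theta>)"
      using AE_lborel_singleton[of "2 * pi"]
      by eventually_elim (auto simp: indicator_def scaleR_conv_of_real)
  qed auto
  also have "?R = complex_of_real (1 / (2 * pi)) * (LBINT \<theta>. indicator {0..2 * pi} \<theta> *\<^sub>R ?h \<theta>)"
    by (rule integral_mult_right_zero)
  finally show ?thesis
    by (simp only: set_lebesgue_integral_def mult.commute[of "f (\<xi> * sin _)"])
qed

lemma integrable_wild_prod:
  fixes f g :: "real \<Rightarrow> complex"
  assumes [measurable]: "f \<in> borel_measurable borel" "g \<in> borel_measurable borel"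
    and "\<And>\<xi>. norm (f \<xi>) \<le> a" "\<And>\<xi>. norm (g \<xi>) \<le> b"
  shows "integrable angle_law (\<lambda>\<theta>. f (\<xi> * cos \<theta>) * g (\<xi> * sin \<theta>))"
proof (rule angle_law.integrable_const_bound)
  have "0 \<le> a" using norm_ge_zero assms(3) by (rule order_trans)
  then show "AE \<theta> in angle_law. norm (f (\<xi> * cos \<theta>) * g (\<xi> * sin \<theta>)) \<le> a * b"
    using assms by (auto simp: norm_mult intro!: mult_mono)
qed measurable

text \<open>Lipschitz continuity of the quadratic Wild product on the unit ball of the supremum
  norm, which drives the uniqueness proof. The constant 2 comes from splitting
  \<open>x * y - x' * y'\<close> into \<open>(x - x') * y + x' * (y - y')\<close>.\<close>

lemma norm_wild_prod_diff_le:
  fixes f g :: "real \<Rightarrow> complex"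
  assumes [measurable]: "f \<in> borel_measurable borel" "g \<in> borel_measurable borel"
    and f: "\<And>\<xi>. norm (f \<xi>) \<le> 1" and g: "\<And>\<xi>. norm (g \<xi>) \<le> 1"
    and d: "\<And>\<xi>. norm (f \<xi> - g \<xi>) \<le> d"
  shows "norm (wild_prod f f \<xi> - wild_prod g g \<xi>) \<le> 2 * d"
proof -
  have "0 \<le> d" using norm_ge_zero d by (rule order_trans)
  have "norm (x * y - x' * y') \<le> 2 * d"
    if "norm (x - x') \<le> d" "norm (y - y') \<le> d" "norm y \<le> 1" "norm x' \<le> 1" for x y x' y' :: complex
  proof -
    have "norm (x * y - x' * y') = norm ((x - x') * y + x' * (y - y'))"
      by (simp add: algebra_simps)
    also have "\<dots> \<le> norm (x - x') * norm y + norm x' * norm (y - y')"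
      by (metis norm_triangle_ineq norm_mult)
    also have "\<dots> \<le> d * 1 + 1 * d"
      using that \<open>0 \<le> d\<close> by (intro add_mono mult_mono) auto
    finally show ?thesis by simp
  qed
  note bound = this
  have int: "integrable angle_law (\<lambda>\<theta>. f (\<xi> * cos \<theta>) * f (\<xi> * sin \<theta>))"
      "integrable angle_law (\<lambda>\<theta>. g (\<xi> * cos \<theta>) * g (\<xi> * sin \<theta>))"
    by (intro integrable_wild_prod[where a = 1 and b = 1] f g; simp)+
  have "norm (wild_prod f f \<xi> - wild_prod g g \<xi>) =
      norm (\<integral>\<theta>. f (\<xi> * cos \<theta>) * f (\<xi> * sin \<theta>) - g (\<xi> * cos \<theta>) * g (\<xi> * sin \<theta>) \<partial>angle_law)"
    unfolding wild_prod_def by (simp only: Bochner_Integration.integral_diff[OF int])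
  also have "\<dots> \<le> (\<integral>\<theta>. norm (f (\<xi> * cos \<theta>) * f (\<xi> * sin \<theta>) -
      g (\<xi> * cos \<theta>) * g (\<xi> * sin \<theta>)) \<partial>angle_law)"
    by (rule integral_norm_bound)
  also have "\<dots> \<le> (\<integral>\<theta>. 2 * d \<partial>angle_law)"
    by (intro integral_mono bound f g d integrable_norm Bochner_Integration.integrable_diff int
        angle_law.integrable_const)
  finally show ?thesis
    using angle_law.prob_space by simp
qed

text \<open>These are the majorants of the iterated Gronwall argument: integrating \<open>K\<close>
  times one of them from 0 gives the next.\<close>

lemma power_over_fact_has_vector_derivative:
  fixes K C r :: real
  shows "((\<lambda>r. C * ((K * r) ^ Suc n / fact (Suc n))) has_vector_derivative
    K * (C * ((K * r) ^ n / fact n))) (at r)"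
proof -
  have "((\<lambda>r. (K * r) ^ Suc n) has_real_derivative real (Suc n) * (K * r) ^ n * K) (at r)"
    by (rule DERIV_cong[OF DERIV_power_Suc[OF DERIV_cmult_Id]]) simp
  then have "((\<lambda>r. C * ((K * r) ^ Suc n / fact (Suc n))) has_real_derivative
      C * (real (Suc n) * (K * r) ^ n * K / fact (Suc n))) (at r)"
    by (intro DERIV_cmult DERIV_cdivide)
  moreover have "C * (real (Suc n) * (K * r) ^ n * K / fact (Suc n)) = K * (C * ((K * r) ^ n / fact n))"
    unfolding fact_Suc of_nat_mult by (simp del: of_nat_Suc)
  ultimately show ?thesis
    by (simp only: has_real_derivative_iff_has_vector_derivative)
qed

section \<open>The Wild series\<close>

text \<open>The substitution \<open>\<tau> = 1 - exp (-t)\<close>, \<open>\<psi> = exp t * \<phi>\<close> turns the Kac equation into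
  \<open>\<psi>' = wild_prod \<psi> \<psi>\<close>, which is solved by the power series in \<open>\<tau>\<close> below.\<close>

locale wild_coefficients =
  fixes c :: "nat \<Rightarrow> real \<Rightarrow> complex"
  assumes measurable_c [measurable]: "c n \<in> borel_measurable borel"
    and norm_c_le: "norm (c n \<xi>) \<le> 1"
    and c_Suc: "of_nat (Suc n) * c (Suc n) \<xi> = (\<Sum>i\<le>n. wild_prod (c i) (c (n - i)) \<xi>)"
begin

text \<open>The coefficient \<open>c n\<close> plays the part of the Wild iterate of index
  \<open>n + 1\<close>, so the series starts with exponent 0 and its value at 0 is the initial
  datum. The variable is complex in order to differentiate the power series term by term.\<close>

definition gen :: "complex \<Rightarrow> real \<Rightarrow> complex" where
  "gen \<tau> \<xi> = (\<Sum>n. c n \<xi> * \<tau> ^ n)"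

lemma summable_norm_gen:
  assumes "norm \<tau> < 1"
  shows "summable (\<lambda>n. norm (c n \<xi> * \<tau> ^ n))"
proof (rule summable_comparison_test')
  show "summable (\<lambda>n. norm \<tau> ^ n)" using assms by (simp add: summable_geometric)
qed (use norm_c_le in \<open>auto simp: norm_mult norm_power intro!: mult_left_le_one_le\<close>)

lemma measurable_gen [measurable]: "gen \<tau> \<in> borel_measurable borel"
  unfolding gen_def by measurable

lemma norm_gen_le:
  assumes "norm \<tau> < 1"
  shows "norm (gen \<tau> \<xi>) \<le> 1 / (1 - norm \<tau>)"
proof -
  have "norm (gen \<tau> \<xi>) \<le> (\<Sum>n. norm (c n \<xi> * \<tau> ^ n))"
    unfolding gen_def by (rule summable_norm[OF summable_norm_gen[OF assms]])
  also have "\<dots> \<le> (\<Sum>n. norm \<tau> ^ n)"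
    using assms norm_c_le
    by (intro suminf_le summable_norm_gen)
       (auto simp: norm_mult norm_power summable_geometric intro!: mult_left_le_one_le)
  also have "\<dots> = 1 / (1 - norm \<tau>)"
    using assms by (simp add: suminf_geometric)
  finally show ?thesis .
qed

text \<open>For a fixed angle this is a Cauchy product of absolutely convergent series. Integrating
  it term by term is justified by the summable majorant
  \<open>real (Suc n) * norm \<tau> ^ n\<close>, the derivative of the geometric series.\<close>

lemma wild_prod_gen:
  assumes \<tau>: "norm \<tau> < 1"
  shows "wild_prod (gen \<tau>) (gen \<tau>) \<xi> = (\<Sum>n. (\<Sum>i\<le>n. wild_prod (c i) (c (n - i)) \<xi>) * \<tau> ^ n)"
proof -
  define h where "h n \<theta> = (\<Sum>i\<le>n. c i (\<xi> * cos \<theta>) * c (n - i) (\<xi> * sin \<theta>)) * \<tau> ^ n" for n \<theta>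
  have gen: "gen \<tau> (\<xi> * cos \<theta>) * gen \<tau> (\<xi> * sin \<theta>) = (\<Sum>n. h n \<theta>)" for \<theta>
  proof -
    have "h n \<theta> = (\<Sum>i\<le>n. (c i (\<xi> * cos \<theta>) * \<tau> ^ i) * (c (n - i) (\<xi> * sin \<theta>) * \<tau> ^ (n - i)))" for n
      unfolding h_def sum_distrib_right
    proof (rule sum.cong[OF refl])
      fix i assume "i \<in> {..n}"
      then have "\<tau> ^ n = \<tau> ^ i * \<tau> ^ (n - i)" by (simp flip: power_add)
      then show "c i (\<xi> * cos \<theta>) * c (n - i) (\<xi> * sin \<theta>) * \<tau> ^ n =
          c i (\<xi> * cos \<theta>) * \<tau> ^ i * (c (n - i) (\<xi> * sin \<theta>) * \<tau> ^ (n - i))"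
        by (simp only: mult_ac)
    qed
    with Cauchy_product_sums[OF summable_norm_gen[OF \<tau>] summable_norm_gen[OF \<tau>],
        of "\<xi> * cos \<theta>" "\<xi> * sin \<theta>"]
    show ?thesis
      unfolding gen_def by (simp add: sums_iff)
  qed
  have norm_h: "norm (h n \<theta>) \<le> real (Suc n) * norm \<tau> ^ n" for n \<theta>
  proof -
    have "norm (\<Sum>i\<le>n. c i (\<xi> * cos \<theta>) * c (n - i) (\<xi> * sin \<theta>)) \<le> (\<Sum>i\<le>n. 1)"
      using norm_c_le by (intro sum_norm_le) (auto simp: norm_mult intro!: mult_le_one)
    then show ?thesis
      unfolding h_def norm_mult norm_power by (intro mult_right_mono) auto
  qed
  have summable: "summable (\<lambda>n. real (Suc n) * norm \<tau> ^ n)"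
    using geometric_deriv_sums[of "norm \<tau>"] \<tau> by (simp add: sums_iff)
  have meas [measurable]: "h n \<in> borel_measurable angle_law" for n
    unfolding h_def by measurable
  have int: "integrable angle_law (h n)" for n
    by (rule angle_law.integrable_const_bound[where B = "real (Suc n) * norm \<tau> ^ n"])
       (use norm_h in auto)
  have int_h: "integral\<^sup>L angle_law (h n) = (\<Sum>i\<le>n. wild_prod (c i) (c (n - i)) \<xi>) * \<tau> ^ n" for n
    unfolding h_def wild_prod_def
    by (subst integral_mult_left_zero, subst Bochner_Integration.integral_sum)
       (auto intro!: integrable_wild_prod[where a = 1 and b = 1] norm_c_le)
  have "wild_prod (gen \<tau>) (gen \<tau>) \<xi> = (\<integral>\<theta>. (\<Sum>n. h n \<theta>) \<partial>angle_law)"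
    unfolding wild_prod_def gen ..
  also have "\<dots> = (\<Sum>n. integral\<^sup>L angle_law (h n))"
  proof (rule integral_suminf[OF int])
    show "AE \<theta> in angle_law. summable (\<lambda>n. norm (h n \<theta>))"
      using norm_h by (intro AE_I2 summable_comparison_test'[OF summable]) auto
    have "(\<integral>\<theta>. norm (h n \<theta>) \<partial>angle_law) \<le> (\<integral>\<theta>. real (Suc n) * norm \<tau> ^ n \<partial>angle_law)" for n
      using norm_h int by (intro integral_mono) auto
    then have "(\<integral>\<theta>. norm (h n \<theta>) \<partial>angle_law) \<le> real (Suc n) * norm \<tau> ^ n" for n
      using angle_law.prob_space by simp
    then show "summable (\<lambda>n. \<integral>\<theta>. norm (h n \<theta>) \<partial>angle_law)"
      by (intro summable_comparison_test'[OF summable]) auto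
  qed
  finally show ?thesis by (simp add: int_h)
qed

text \<open>The coefficients of the derivative are the left-hand sides of \<open>c_Suc\<close>, and
  those of the Wild product are the right-hand sides: Wild's recursion is the differential equation
  read coefficientwise.\<close>

lemma DERIV_gen:
  assumes \<tau>: "norm \<tau> < 1"
  shows "((\<lambda>\<tau>. gen \<tau> \<xi>) has_field_derivative wild_prod (gen \<tau>) (gen \<tau>) \<xi>) (at \<tau>)"
proof -
  have "((\<lambda>\<tau>. gen \<tau> \<xi>) has_field_derivative (\<Sum>n. diffs (\<lambda>n. c n \<xi>) n * \<tau> ^ n)) (at \<tau>)"
    unfolding gen_def
    using \<tau> by (intro termdiffs_strong'[where K = 1] summable_norm_cancel[OF summable_norm_gen])
  then show ?thesis
    unfolding wild_prod_gen[OF \<tau>] diffs_def c_Suc .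
qed

definition wild :: "real \<Rightarrow> real \<Rightarrow> complex" where
  "wild t \<xi> = of_real (exp (-t)) * gen (of_real (1 - exp (-t))) \<xi>"

lemma measurable_wild [measurable]: "wild t \<in> borel_measurable borel"
  unfolding wild_def by measurable

text \<open>At \<open>1 - exp (-t)\<close> the geometric bound for \<open>gen\<close> equals
  \<open>exp t\<close>, which the prefactor cancels.\<close>

lemma norm_wild_le:
  assumes "0 \<le> t"
  shows "norm (wild t \<xi>) \<le> 1"
proof -
  have norm: "norm (complex_of_real (1 - exp (-t))) = 1 - exp (-t)"
    using assms by (subst norm_of_real) simp
  have "norm (gen (of_real (1 - exp (-t))) \<xi>) \<le> 1 / (1 - norm (complex_of_real (1 - exp (-t))))"
    by (rule norm_gen_le, unfold norm) simp
  then show ?thesis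
    unfolding norm by (simp add: wild_def norm_mult pos_le_divide_eq mult.commute)
qed

lemma wild_0: "wild 0 \<xi> = c 0 \<xi>"
  by (simp add: wild_def gen_def)

lemma wild_prod_wild:
  "wild_prod (wild t) (wild t) \<xi> = of_real (exp (-t)) * of_real (exp (-t)) *
    wild_prod (gen (of_real (1 - exp (-t)))) (gen (of_real (1 - exp (-t)))) \<xi>"
  unfolding wild_prod_def wild_def
  by (simp add: mult.assoc mult.left_commute)

text \<open>The chain rule contributes a second factor \<open>exp (-t)\<close>, which completes the
  Wild product of \<open>wild t\<close> with itself; differentiating the prefactor yields the loss
  term.\<close>

lemma wild_has_vector_derivative:
  assumes "0 \<le> t"
  shows "((\<lambda>t. wild t \<xi>) has_vector_derivative wild_prod (wild t) (wild t) \<xi> - wild t \<xi>) (at t)"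
proof -
  let ?\<tau> = "\<lambda>t. complex_of_real (1 - exp (-t))"
  have "norm (?\<tau> t) < 1" using assms by (subst norm_of_real) simp
  moreover have "(?\<tau> has_vector_derivative of_real (exp (-t))) (at t)"
    by (rule has_vector_derivative_of_real) (auto intro!: derivative_eq_intros)
  ultimately have "((\<lambda>t. gen (?\<tau> t) \<xi>) has_vector_derivative
      of_real (exp (-t)) * wild_prod (gen (?\<tau> t)) (gen (?\<tau> t)) \<xi>) (at t)"
    using field_vector_diff_chain_at[OF _ DERIV_gen] by (simp add: o_def)
  moreover have "((\<lambda>t. complex_of_real (exp (-t))) has_vector_derivative - of_real (exp (-t))) (at t)"
    using has_vector_derivative_of_real[of "\<lambda>t. exp (-t)" "- exp (-t)" "at t"]
    by (auto intro!: derivative_eq_intros)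
  ultimately have "((\<lambda>t. wild t \<xi>) has_vector_derivative
      of_real (exp (-t)) * (of_real (exp (-t)) * wild_prod (gen (?\<tau> t)) (gen (?\<tau> t)) \<xi>) +
      - of_real (exp (-t)) * gen (?\<tau> t) \<xi>) (at t)"
    unfolding wild_def by (intro has_vector_derivative_mult)
  then show ?thesis
    by (simp add: wild_prod_wild wild_def mult.assoc)
qed

section \<open>Uniqueness of bounded solutions\<close>

lemma kac_solution_eq_wild:
  assumes sol: "kac_solution (c 0) \<phi>"
    and meas: "\<And>s. 0 \<le> s \<Longrightarrow> (\<lambda>\<xi>. \<phi> \<xi> s) \<in> borel_measurable borel"
    and bounded: "\<And>s \<xi>. 0 \<le> s \<Longrightarrow> norm (\<phi> \<xi> s) \<le> 1"
    and t: "0 \<le> t"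
  shows "\<phi> \<xi> t = wild t \<xi>"
proof -
  \<comment> \<open>Gronwall's argument in iterated form: a supremum over \<open>\<xi>\<close> of the difference need not be
    measurable in time, whereas bounds uniform in \<open>\<xi>\<close> can be improved pointwise.\<close>
  define K where "K = 2 * exp t"
  then have "0 \<le> K" by simp
  \<comment> \<open>The leading 2 bounds the difference of two functions of norm at most 1. In
    \<open>K\<close>, the 2 is the Lipschitz constant of the Wild product and \<open>exp t\<close>
    bounds the integrating factor up to time \<open>t\<close>.\<close>
  have bound: "norm (\<phi> \<xi> s - wild s \<xi>) \<le> 2 * ((K * s) ^ n / fact n)" if "0 \<le> s" "s \<le> t" for n s \<xi>
    using that
  proof (induction n arbitrary: s \<xi>)
    case 0
    then show ?case
      using norm_triangle_ineq4[of "\<phi> \<xi> s" "wild s \<xi>"] bounded[of s \<xi>] norm_wild_le[of s \<xi>] by simp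
  next
    case (Suc n)
    \<comment> \<open>The integrating factor removes the loss term, so that \<open>D'\<close>
      contains only the difference of the Wild products, to which the induction hypothesis applies
      at all frequencies at once.\<close>
    define D where "D r = of_real (exp r) * (\<phi> \<xi> r - wild r \<xi>)" for r
    define D' where "D' r = of_real (exp r) *
      (wild_prod (\<lambda>\<xi>. \<phi> \<xi> r) (\<lambda>\<xi>. \<phi> \<xi> r) \<xi> - wild_prod (wild r) (wild r) \<xi>)" for r
    have deriv_\<phi>: "((\<phi> \<xi>) has_vector_derivative
        wild_prod (\<lambda>\<xi>. \<phi> \<xi> r) (\<lambda>\<xi>. \<phi> \<xi> r) \<xi> - \<phi> \<xi> r) (at r)" if "0 < r" for r
    proof -
      have "((\<phi> \<xi>) has_vector_derivative complex_of_real (1 / (2 * pi)) *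
          (LBINT \<theta>:{0..2 * pi}. \<phi> (\<xi> * sin \<theta>) r * \<phi> (\<xi> * cos \<theta>) r) - \<phi> \<xi> r) (at r)"
        using sol that unfolding kac_solution_def by blast
      then show ?thesis
        by (subst (asm) kac_integral_eq_wild_prod) (use that in \<open>auto intro: meas\<close>)
    qed
    have "(D has_vector_derivative D' r) (at r)" if "0 < r" for r
    proof -
      have "((\<lambda>r. complex_of_real (exp r)) has_vector_derivative of_real (exp r)) (at r)"
        by (rule has_vector_derivative_of_real) (auto intro!: derivative_eq_intros)
      from has_vector_derivative_mult[OF this has_vector_derivative_diff[OF deriv_\<phi>[OF that]
          wild_has_vector_derivative[of r \<xi>]]] that
      show ?thesis
        unfolding D_def D'_def by (simp add: algebra_simps)
    qed
    note deriv = this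
    have "continuous_on {0..s} D"
      unfolding D_def
    proof (intro continuous_intros)
      show "continuous_on {0..s} (\<lambda>r. wild r \<xi>)"
        by (intro continuous_at_imp_continuous_on ballI
            has_vector_derivative_continuous[OF wild_has_vector_derivative]) auto
      \<comment> \<open>Differentiability gives continuity at positive times only; at time 0 it
        comes from the right limit in \<open>kac_solution\<close>.\<close>
      have "continuous (at r within {0..s}) (\<phi> \<xi>)" if "r \<in> {0..s}" for r
      proof (cases "r = 0")
        case True
        have "(\<phi> \<xi> \<longlongrightarrow> \<phi> \<xi> 0) (at_right 0)"
          using sol unfolding kac_solution_def by simp
        then have "(\<phi> \<xi> \<longlongrightarrow> \<phi> \<xi> 0) (at 0 within {0..})"
          by (simp add: at_within_Ici_at_right)
        then show ?thesis
          unfolding True continuous_within by (rule tendsto_within_subset) auto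
      next
        case False
        with that have "0 < r" by simp
        then show ?thesis
          by (rule continuous_at_imp_continuous_at_within[OF
              has_vector_derivative_continuous[OF deriv_\<phi>]])
      qed
      then show "continuous_on {0..s} (\<phi> \<xi>)"
        by (simp add: continuous_on_eq_continuous_within)
    qed
    moreover have "norm (D' r) \<le> K * (2 * ((K * r) ^ n / fact n))" if "0 < r" "r < s" for r
    proof -
      have nonneg: "0 \<le> (K * r) ^ n / fact n"
        using that \<open>0 \<le> K\<close> by simp
      have "norm (D' r) \<le> exp r * (2 * (2 * ((K * r) ^ n / fact n)))"
        unfolding D'_def norm_mult
        using that Suc.prems nonneg
        by (intro mult_mono norm_wild_prod_diff_le Suc.IH meas bounded norm_wild_le measurable_wild) auto
      also have "\<dots> \<le> exp t * (2 * (2 * ((K * r) ^ n / fact n)))"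
        using that Suc.prems nonneg by (intro mult_right_mono) auto
      also have "\<dots> = K * (2 * ((K * r) ^ n / fact n))"
        unfolding K_def by (simp only: mult_ac)
      finally show ?thesis .
    qed
    moreover have "continuous_on {0..s} (\<lambda>r. 2 * ((K * r) ^ Suc n / fact (Suc n)))"
      by (intro continuous_intros) simp
    \<comment> \<open>This form of the mean value inequality needs derivatives only in the open
      interval, so nothing is asked of the equation at time 0.\<close>
    ultimately have "norm (D s - D 0) \<le>
        2 * ((K * s) ^ Suc n / fact (Suc n)) - 2 * ((K * 0) ^ Suc n / fact (Suc n))" if "0 < s"
      using that
      by (intro differentiable_bound_general[where f' = D' and
            \<phi>' = "\<lambda>r. K * (2 * ((K * r) ^ n / fact n))"]
          deriv power_over_fact_has_vector_derivative)
    moreover have "D 0 = 0"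
      using sol by (simp add: D_def wild_0 kac_solution_def)
    ultimately have "norm (D s) \<le> 2 * ((K * s) ^ Suc n / fact (Suc n))"
      using Suc.prems by (cases "s = 0") simp_all
    moreover have "norm (\<phi> \<xi> s - wild s \<xi>) \<le> norm (D s)"
      using mult_right_mono[of 1 "exp s" "norm (\<phi> \<xi> s - wild s \<xi>)"] Suc.prems
      by (simp add: D_def norm_mult)
    ultimately show ?case by linarith
  qed
  have "(\<lambda>n. 2 * ((K * t) ^ n / fact n)) \<longlonglongrightarrow> 0"
    using tendsto_mult_right_zero[OF summable_LIMSEQ_zero[OF summable_exp[of "K * t"]], of 2]
    by (simp only: divide_inverse mult.commute)
  then have "norm (\<phi> \<xi> t - wild t \<xi>) \<le> 0"
    by (rule LIMSEQ_le_const) (use bound[OF t order_refl] in blast)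
  then show ?thesis by simp
qed

end

section \<open>Sums over trees\<close>

lemma leaves_pos: "0 < leaves \<gamma>"
  by (induction \<gamma>) auto

lemma tree_prob_nonneg: "0 \<le> tree_prob \<gamma>"
proof (induction \<gamma>)
  case (Node l r)
  have "1 \<le> real (leaves (Node l r))"
    using leaves_pos[of l] by simp
  with Node show ?case by simp
qed simp

lemma G_0: "G 0 = {}"
  using leaves_pos by (force simp: G_def)

lemma G_1: "G (Suc 0) = {Leaf}"
proof -
  have "leaves \<gamma> = Suc 0 \<longleftrightarrow> \<gamma> = Leaf" for \<gamma>
  proof (cases \<gamma>)
    case (Node l r)
    then show ?thesis using leaves_pos[of l] leaves_pos[of r] by auto
  qed simp
  then show ?thesis by (auto simp: G_def)
qed

lemma G_Suc_Suc:
  "G (Suc (Suc n)) = (\<lambda>(i, l, r). Node l r) ` (SIGMA i:{..n}. G (Suc i) \<times> G (Suc (n - i)))"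
proof (intro set_eqI iffI)
  fix \<gamma> assume "\<gamma> \<in> G (Suc (Suc n))"
  then have \<gamma>: "leaves \<gamma> = Suc (Suc n)" by (simp add: G_def)
  then obtain l r where Node: "\<gamma> = Node l r" by (cases \<gamma>) auto
  from leaves_pos[of l] leaves_pos[of r] obtain i j where "leaves l = Suc i" "leaves r = Suc j"
    by (metis gr0_implies_Suc)
  with \<gamma> Node show "\<gamma> \<in> (\<lambda>(i, l, r). Node l r) ` (SIGMA i:{..n}. G (Suc i) \<times> G (Suc (n - i)))"
    by (intro image_eqI[where x = "(i, l, r)"]) (auto simp: G_def)
qed (auto simp: G_def)

lemma finite_G: "finite (G n)"
proof (induction n rule: less_induct)
  case (less n)
  consider "n = 0" | "n = Suc 0" | m where "n = Suc (Suc m)"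
    by (metis not0_implies_Suc)
  then show ?case
  proof cases
    case (3 m)
    have "finite (SIGMA i:{..m}. G (Suc i) \<times> G (Suc (m - i)))"
      by (intro finite_SigmaI finite_cartesian_product less) (auto simp: 3)
    then show ?thesis unfolding 3 G_Suc_Suc by (rule finite_imageI)
  qed (simp_all add: G_0 G_1)
qed

lemma countable_trees: "countable (A :: mckean set)"
proof (rule countable_subset)
  show "A \<subseteq> (\<Union>n. G n)" by (auto simp: G_def)
  show "countable (\<Union>n. G n)" by (rule countable_UN) (simp_all add: countable_finite finite_G)
qed

text \<open>The root factor of \<open>tree_prob\<close> depends only on the total number of leaves,
  so it leaves the sum and cancels. Vector values allow the same identity to serve for total mass
  and for characteristic functions.\<close>

lemma sum_G_Suc_Suc:
  fixes f :: "mckean \<Rightarrow> 'a::real_vector"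
  shows "real (Suc n) *\<^sub>R (\<Sum>\<gamma>\<in>G (Suc (Suc n)). tree_prob \<gamma> *\<^sub>R f \<gamma>) =
    (\<Sum>i\<le>n. \<Sum>l\<in>G (Suc i). \<Sum>r\<in>G (Suc (n - i)). (tree_prob l * tree_prob r) *\<^sub>R f (Node l r))"
proof -
  let ?S = "SIGMA i:{..n}. G (Suc i) \<times> G (Suc (n - i))"
  have "inj_on (\<lambda>(i, l, r). Node l r) ?S"
    by (auto simp: inj_on_def G_def)
  then have "real (Suc n) *\<^sub>R (\<Sum>\<gamma>\<in>G (Suc (Suc n)). tree_prob \<gamma> *\<^sub>R f \<gamma>) =
      real (Suc n) *\<^sub>R (\<Sum>(i, l, r)\<in>?S. tree_prob (Node l r) *\<^sub>R f (Node l r))"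
    unfolding G_Suc_Suc by (subst sum.reindex) (simp_all add: case_prod_unfold)
  also have "\<dots> = (\<Sum>(i, l, r)\<in>?S. (tree_prob l * tree_prob r) *\<^sub>R f (Node l r))"
    unfolding scaleR_sum_right
  proof (rule sum.cong[OF refl], clarify)
    fix i l r assume "i \<le> n" "l \<in> G (Suc i)" "r \<in> G (Suc (n - i))"
    then have "leaves (Node l r) = Suc (Suc n)" by (simp add: G_def)
    then have "real (leaves (Node l r)) - 1 = real (Suc n)" by simp
    then show "real (Suc n) *\<^sub>R tree_prob (Node l r) *\<^sub>R f (Node l r) =
        (tree_prob l * tree_prob r) *\<^sub>R f (Node l r)"
      by (simp del: leaves.simps of_nat_Suc)
  qed
  also have "\<dots> = (\<Sum>i\<le>n. \<Sum>l\<in>G (Suc i). \<Sum>r\<in>G (Suc (n - i)). (tree_prob l * tree_prob r) *\<^sub>R f (Node l r))"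
    by (subst sum.Sigma[symmetric]) (simp_all add: finite_G sum.cartesian_product)
  finally show ?thesis .
qed

text \<open>By induction each of the \<open>m + 1\<close> ways to split the leaves at the root has
  total weight 1 before normalisation.\<close>

lemma sum_tree_prob: "(\<Sum>\<gamma>\<in>G (Suc n). tree_prob \<gamma>) = 1"
proof (induction n rule: less_induct)
  case (less n)
  show ?case
  proof (cases n)
    case (Suc m)
    have "real (Suc m) * (\<Sum>\<gamma>\<in>G (Suc (Suc m)). tree_prob \<gamma>) =
        (\<Sum>i\<le>m. (\<Sum>l\<in>G (Suc i). tree_prob l) * (\<Sum>r\<in>G (Suc (m - i)). tree_prob r))"
      using sum_G_Suc_Suc[of m "\<lambda>_. 1 :: real"] by (simp add: sum_product)
    also have "\<dots> = (\<Sum>i\<le>m. 1)"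
      by (intro sum.cong refl) (simp add: less Suc)
    finally show ?thesis
      unfolding Suc by (simp del: of_nat_Suc)
  qed (simp add: G_1)
qed

section \<open>The law attached to a tree\<close>

text \<open>A description without coordinates or node order: an independent angle at the root and
  independent values of the two subtrees. That the weighted leaf sum has this law is
  \<open>distr_tree_val\<close>.\<close>

fun tree_law :: "real measure \<Rightarrow> mckean \<Rightarrow> real measure" where
  "tree_law \<mu> Leaf = \<mu>"
| "tree_law \<mu> (Node l r) = distr (angle_law \<Otimes>\<^sub>M (tree_law \<mu> l \<Otimes>\<^sub>M tree_law \<mu> r)) borel
    (\<lambda>(\<theta>, x, y). cos \<theta> * x + sin \<theta> * y)"

lemma real_distribution_tree_law:
  assumes "real_distribution \<mu>"
  shows "real_distribution (tree_law \<mu> \<gamma>)"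
proof (induction \<gamma>)
  case (Node l r)
  interpret l: real_distribution "tree_law \<mu> l" by fact
  interpret r: real_distribution "tree_law \<mu> r" by fact
  interpret lr: pair_prob_space "tree_law \<mu> l" "tree_law \<mu> r" ..
  interpret alr: pair_prob_space angle_law "tree_law \<mu> l \<Otimes>\<^sub>M tree_law \<mu> r" ..
  show ?case
    unfolding tree_law.simps by (rule alr.real_distribution_distr) measurable
qed (simp add: assms)

text \<open>Once the root angle is fixed by Fubini, the exponential factors, and the inner integrals
  are the two characteristic functions at \<open>\<xi> * cos \<theta>\<close> and
  \<open>\<xi> * sin \<theta>\<close>.\<close>

lemma char_tree_law_Node:
  assumes \<mu>: "real_distribution \<mu>"
  shows "char (tree_law \<mu> (Node l r)) \<xi> = wild_prod (char (tree_law \<mu> l)) (char (tree_law \<mu> r)) \<xi>"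
proof -
  interpret l: real_distribution "tree_law \<mu> l" by (rule real_distribution_tree_law[OF \<mu>])
  interpret r: real_distribution "tree_law \<mu> r" by (rule real_distribution_tree_law[OF \<mu>])
  interpret lr: pair_prob_space "tree_law \<mu> l" "tree_law \<mu> r" ..
  interpret alr: pair_prob_space angle_law "tree_law \<mu> l \<Otimes>\<^sub>M tree_law \<mu> r" ..
  have "char (tree_law \<mu> (Node l r)) \<xi> =
      (\<integral>(\<theta>, x, y). iexp (\<xi> * (cos \<theta> * x + sin \<theta> * y)) \<partial>(angle_law \<Otimes>\<^sub>M (tree_law \<mu> l \<Otimes>\<^sub>M tree_law \<mu> r)))"
    unfolding char_def tree_law.simps by (subst integral_distr) (auto simp: case_prod_unfold)
  also have "\<dots> = (\<integral>\<theta>. (\<integral>(x, y). iexp (\<xi> * (cos \<theta> * x + sin \<theta> * y)) \<partial>(tree_law \<mu> l \<Otimes>\<^sub>M tree_law \<mu> r)) \<partial>angle_law)"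
    by (subst alr.integral_fst'[symmetric])
       (auto simp: case_prod_unfold intro!: alr.integrable_const_bound[where B = 1])
  also have "\<dots> = (\<integral>\<theta>. (\<integral>x. (\<integral>y. iexp (\<xi> * (cos \<theta> * x + sin \<theta> * y)) \<partial>tree_law \<mu> r) \<partial>tree_law \<mu> l) \<partial>angle_law)"
    by (subst lr.integral_fst'[symmetric])
       (auto simp: case_prod_unfold intro!: lr.integrable_const_bound[where B = 1])
  also have "\<dots> = (\<integral>\<theta>. (\<integral>x. (\<integral>y. iexp (\<xi> * cos \<theta> * x) * iexp (\<xi> * sin \<theta> * y) \<partial>tree_law \<mu> r) \<partial>tree_law \<mu> l) \<partial>angle_law)"
    by (simp add: algebra_simps exp_add[symmetric])
  also have "\<dots> = wild_prod (char (tree_law \<mu> l)) (char (tree_law \<mu> r)) \<xi>"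
    unfolding wild_prod_def char_def by simp
  finally show ?thesis .
qed

lemma wild_prod_sum:
  fixes F H :: "'a \<Rightarrow> real \<Rightarrow> complex"
  assumes "\<And>l. l \<in> A \<Longrightarrow> F l \<in> borel_measurable borel" "\<And>r. r \<in> B \<Longrightarrow> H r \<in> borel_measurable borel"
    and "\<And>l \<xi>. l \<in> A \<Longrightarrow> norm (F l \<xi>) \<le> 1" "\<And>r \<xi>. r \<in> B \<Longrightarrow> norm (H r \<xi>) \<le> 1"
  shows "wild_prod (\<lambda>\<xi>. \<Sum>l\<in>A. a l *\<^sub>R F l \<xi>) (\<lambda>\<xi>. \<Sum>r\<in>B. b r *\<^sub>R H r \<xi>) \<xi> =
    (\<Sum>l\<in>A. \<Sum>r\<in>B. (a l * b r) *\<^sub>R wild_prod (F l) (H r) \<xi>)"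
proof -
  have int: "integrable angle_law (\<lambda>\<theta>. F l (\<xi> * cos \<theta>) * H r (\<xi> * sin \<theta>))" if "l \<in> A" "r \<in> B" for l r
    using that by (intro integrable_wild_prod[where a = 1 and b = 1] assms)
  have "wild_prod (\<lambda>\<xi>. \<Sum>l\<in>A. a l *\<^sub>R F l \<xi>) (\<lambda>\<xi>. \<Sum>r\<in>B. b r *\<^sub>R H r \<xi>) \<xi> =
      (\<integral>\<theta>. (\<Sum>l\<in>A. \<Sum>r\<in>B. (a l * b r) *\<^sub>R (F l (\<xi> * cos \<theta>) * H r (\<xi> * sin \<theta>))) \<partial>angle_law)"
    unfolding wild_prod_def by (simp add: sum_product mult.commute)
  also have "\<dots> = (\<Sum>l\<in>A. \<Sum>r\<in>B. \<integral>\<theta>. (a l * b r) *\<^sub>R (F l (\<xi> * cos \<theta>) * H r (\<xi> * sin \<theta>)) \<partial>angle_law)"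
    using int by (simp add: Bochner_Integration.integral_sum)
  finally show ?thesis
    by (simp add: wild_prod_def)
qed

text \<open>This is the Wild iterate of index \<open>n + 1\<close> started from
  \<open>char \<mu>\<close>; the recursion is verified in the next lemma.\<close>

definition wild_coeff :: "real measure \<Rightarrow> nat \<Rightarrow> real \<Rightarrow> complex" where
  "wild_coeff \<mu> n \<xi> = (\<Sum>\<gamma>\<in>G (Suc n). tree_prob \<gamma> *\<^sub>R char (tree_law \<mu> \<gamma>) \<xi>)"

lemma wild_coefficients_wild_coeff:
  assumes \<mu>: "real_distribution \<mu>"
  shows "wild_coefficients (wild_coeff \<mu>)"
proof
  note meas [measurable] = real_distribution.char_measurable[OF real_distribution_tree_law[OF \<mu>]]
  note bound = real_distribution.cmod_char_le_1[OF real_distribution_tree_law[OF \<mu>]]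
  show "wild_coeff \<mu> n \<in> borel_measurable borel" for n
    unfolding wild_coeff_def by measurable
  show "norm (wild_coeff \<mu> n \<xi>) \<le> 1" for n \<xi>
  proof -
    have "norm (wild_coeff \<mu> n \<xi>) \<le> (\<Sum>\<gamma>\<in>G (Suc n). tree_prob \<gamma>)"
      unfolding wild_coeff_def
      by (intro sum_norm_le) (auto simp: tree_prob_nonneg intro!: mult_left_le bound)
    then show ?thesis by (simp add: sum_tree_prob)
  qed
  show "of_nat (Suc n) * wild_coeff \<mu> (Suc n) \<xi> =
      (\<Sum>i\<le>n. wild_prod (wild_coeff \<mu> i) (wild_coeff \<mu> (n - i)) \<xi>)" for n \<xi>
  proof -
    have "of_nat (Suc n) * wild_coeff \<mu> (Suc n) \<xi> = real (Suc n) *\<^sub>R wild_coeff \<mu> (Suc n) \<xi>"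
      by (simp add: scaleR_conv_of_real)
    also have "\<dots> = (\<Sum>i\<le>n. \<Sum>l\<in>G (Suc i). \<Sum>r\<in>G (Suc (n - i)).
        (tree_prob l * tree_prob r) *\<^sub>R wild_prod (char (tree_law \<mu> l)) (char (tree_law \<mu> r)) \<xi>)"
      unfolding wild_coeff_def sum_G_Suc_Suc char_tree_law_Node[OF \<mu>] ..
    also have "\<dots> = (\<Sum>i\<le>n. wild_prod (wild_coeff \<mu> i) (wild_coeff \<mu> (n - i)) \<xi>)"
      unfolding wild_coeff_def by (simp add: wild_prod_sum meas bound)
    finally show ?thesis .
  qed
qed

lemma wild_coeff_0: "wild_coeff \<mu> 0 = char \<mu>"
  by (simp add: wild_coeff_def G_1 fun_eq_iff)

section \<open>Weighted leaf sums\<close>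

text \<open>Angles and leaf variables are combined into one family, indexed by \<open>Inl\<close> and \<open>Inr\<close>
  respectively, so that disjoint subtrees use disjoint sets of coordinates. The leaves are numbered
  from \<open>k\<close> on.\<close>

fun tree_val :: "mckean \<Rightarrow> (child list \<Rightarrow> nat) \<Rightarrow> nat \<Rightarrow> (nat + nat \<Rightarrow> real) \<Rightarrow> real" where
  "tree_val Leaf ord k z = z (Inr k)"
| "tree_val (Node l r) ord k z =
    cos (z (Inl (ord []))) * tree_val l (\<lambda>p. ord (LeftChild # p)) k z +
    sin (z (Inl (ord []))) * tree_val r (\<lambda>p. ord (RightChild # p)) (k + leaves l) z"

text \<open>The coordinates read by \<open>tree_val\<close>. For the two subtrees of a root they are
  disjoint because the order is injective and the leaf intervals are consecutive.\<close>

definition tree_coords :: "mckean \<Rightarrow> (child list \<Rightarrow> nat) \<Rightarrow> nat \<Rightarrow> (nat + nat) set" where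
  [simp]: "tree_coords \<gamma> ord k = Inl ` ord ` nodes \<gamma> \<union> Inr ` {k..<k + leaves \<gamma>}"

lemma length_leaf_paths: "length (leaf_paths \<gamma>) = leaves \<gamma>"
  by (induction \<gamma>) auto

lemma sum_lessThan_add:
  fixes f :: "nat \<Rightarrow> 'a::comm_monoid_add"
  shows "(\<Sum>j<m + n. f j) = (\<Sum>j<m. f j) + (\<Sum>j<n. f (m + j))"
  by (induction n) (simp_all add: ac_simps)

definition path_coeff :: "(child list \<Rightarrow> nat) \<Rightarrow> (nat + nat \<Rightarrow> real) \<Rightarrow> child list \<Rightarrow> real" where
  "path_coeff ord z p = (\<Prod>i<length p. edge_factor (p ! i) (z (Inl (ord (take i p)))))"

lemma path_coeff_Cons:
  "path_coeff ord z (d # p) = edge_factor d (z (Inl (ord []))) * path_coeff (\<lambda>p. ord (d # p)) z p"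
  by (simp add: path_coeff_def prod.lessThan_Suc_shift del: prod.lessThan_Suc)

text \<open>The edge below the root factors out of every path, with cosine for the leaves of the
  left subtree, which come first, and sine for the others. Order and first leaf number vary in the
  induction, as the right subtree starts at leaf \<open>k + leaves l\<close>.\<close>

lemma sum_path_coeff:
  "(\<Sum>j<leaves \<gamma>. path_coeff ord z (leaf_paths \<gamma> ! j) * z (Inr (k + j))) = tree_val \<gamma> ord k z"
proof (induction \<gamma> arbitrary: ord k)
  case Leaf
  show ?case by (simp add: path_coeff_def)
next
  case (Node l r)
  have "(\<Sum>j<leaves l. path_coeff ord z (leaf_paths (Node l r) ! j) * z (Inr (k + j))) =
      cos (z (Inl (ord []))) * tree_val l (\<lambda>p. ord (LeftChild # p)) k z"
    unfolding Node.IH(1)[symmetric] sum_distrib_left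
    by (intro sum.cong refl)
       (simp add: nth_append length_leaf_paths path_coeff_Cons mult.assoc)
  moreover have "(\<Sum>j<leaves r. path_coeff ord z (leaf_paths (Node l r) ! (leaves l + j)) *
        z (Inr (k + (leaves l + j)))) =
      sin (z (Inl (ord []))) * tree_val r (\<lambda>p. ord (RightChild # p)) (k + leaves l) z"
    unfolding Node.IH(2)[symmetric] sum_distrib_left
    by (intro sum.cong refl)
       (simp add: nth_append length_leaf_paths path_coeff_Cons mult.assoc add.assoc)
  ultimately show ?case
    by (simp only: leaves.simps sum_lessThan_add tree_val.simps)
qed

lemma sum_leaf_coeff:
  "(\<Sum>j<leaves \<gamma>. leaf_coeff ord j \<gamma> \<theta> * x j) = tree_val \<gamma> (ord \<gamma>) 0 (case_sum \<theta> x)"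
  unfolding sum_path_coeff[symmetric]
  by (intro sum.cong refl) (simp add: leaf_coeff_def path_coeff_def Let_def)

text \<open>This permits restricting the family to the coordinates of a subtree, the form in which
  independence of blocks is available.\<close>

lemma tree_val_cong:
  assumes "\<And>i. i \<in> tree_coords \<gamma> ord k \<Longrightarrow> z i = z' i"
  shows "tree_val \<gamma> ord k z = tree_val \<gamma> ord k z'"
  using assms
proof (induction \<gamma> arbitrary: ord k)
  case (Node l r)
  have "tree_val l (\<lambda>p. ord (LeftChild # p)) k z = tree_val l (\<lambda>p. ord (LeftChild # p)) k z'"
    by (intro Node.IH(1) Node.prems) (auto simp: image_iff)
  moreover have "tree_val r (\<lambda>p. ord (RightChild # p)) (k + leaves l) z =
      tree_val r (\<lambda>p. ord (RightChild # p)) (k + leaves l) z'"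
    by (intro Node.IH(2) Node.prems) (auto simp: image_iff)
  ultimately show ?case
    using Node.prems[of "Inl (ord [])"] by simp
qed simp

lemma measurable_tree_val:
  assumes "tree_coords \<gamma> ord k \<subseteq> J"
  shows "tree_val \<gamma> ord k \<in> (\<Pi>\<^sub>M i\<in>J. borel) \<rightarrow>\<^sub>M borel"
  using assms
proof (induction \<gamma> arbitrary: ord k)
  case Leaf
  then show ?case by (simp add: measurable_component_singleton)
next
  case (Node l r)
  have [measurable]: "tree_val l (\<lambda>p. ord (LeftChild # p)) k \<in> (\<Pi>\<^sub>M i\<in>J. borel) \<rightarrow>\<^sub>M borel"
    by (rule Node.IH(1), rule subset_trans[OF _ Node.prems]) (auto simp: image_iff)
  have [measurable]: "tree_val r (\<lambda>p. ord (RightChild # p)) (k + leaves l) \<in> (\<Pi>\<^sub>M i\<in>J. borel) \<rightarrow>\<^sub>M borel"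
    by (rule Node.IH(2), rule subset_trans[OF _ Node.prems]) (auto simp: image_iff)
  have [measurable]: "(\<lambda>z. z (Inl (ord []))) \<in> (\<Pi>\<^sub>M i\<in>J. borel) \<rightarrow>\<^sub>M borel"
    using Node.prems by (intro measurable_component_singleton) auto
  show ?case
    unfolding tree_val.simps by measurable
qed

text \<open>Functions of disjoint blocks of an independent family are independent; this is stated as
  an identity of product measures to match the recursion of \<open>tree_law\<close>.\<close>

lemma (in prob_space) distr_disjoint_coords:
  assumes indep: "indep_vars M' Z UNIV" and disj: "J \<inter> K = {}"
    and f: "f \<in> PiM J M' \<rightarrow>\<^sub>M N" and g: "g \<in> PiM K M' \<rightarrow>\<^sub>M L"
  shows "distr M N (\<lambda>\<omega>. f (restrict (\<lambda>i. Z i \<omega>) J)) \<Otimes>\<^sub>M distr M L (\<lambda>\<omega>. g (restrict (\<lambda>i. Z i \<omega>) K)) =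
    distr M (N \<Otimes>\<^sub>M L) (\<lambda>\<omega>. (f (restrict (\<lambda>i. Z i \<omega>) J), g (restrict (\<lambda>i. Z i \<omega>) K)))"
proof -
  define X where "X \<omega> = restrict (\<lambda>i. Z i \<omega>) J" for \<omega>
  define Y where "Y \<omega> = restrict (\<lambda>i. Z i \<omega>) K" for \<omega>
  have X: "X \<in> M \<rightarrow>\<^sub>M PiM J M'" and Y: "Y \<in> M \<rightarrow>\<^sub>M PiM K M'"
    and XY: "distr M (PiM J M') X \<Otimes>\<^sub>M distr M (PiM K M') Y =
      distr M (PiM J M' \<Otimes>\<^sub>M PiM K M') (\<lambda>\<omega>. (X \<omega>, Y \<omega>))"
    using indep_var_restrict[OF indep disj subset_UNIV subset_UNIV]
    by (simp_all add: indep_var_distribution_eq X_def[abs_def] Y_def[abs_def])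
  have distr_f: "distr M N (\<lambda>\<omega>. f (X \<omega>)) = distr (distr M (PiM J M') X) N f"
    using f X by (simp add: distr_distr o_def)
  have distr_g: "distr M L (\<lambda>\<omega>. g (Y \<omega>)) = distr (distr M (PiM K M') Y) L g"
    using g Y by (simp add: distr_distr o_def)
  interpret gY: prob_space "distr (distr M (PiM K M') Y) L g"
    unfolding distr_g[symmetric] by (rule prob_space_distr[OF measurable_compose[OF Y g]])
  have "distr M N (\<lambda>\<omega>. f (X \<omega>)) \<Otimes>\<^sub>M distr M L (\<lambda>\<omega>. g (Y \<omega>)) =
      distr (distr M (PiM J M') X \<Otimes>\<^sub>M distr M (PiM K M') Y) (N \<Otimes>\<^sub>M L) (\<lambda>(x, y). (f x, g y))"
    unfolding distr_f distr_g
    by (intro pair_measure_distr) (simp_all add: f g gY.sigma_finite_measure_axioms)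
  also have "\<dots> = distr M (N \<Otimes>\<^sub>M L) ((\<lambda>(x, y). (f x, g y)) \<circ> (\<lambda>\<omega>. (X \<omega>, Y \<omega>)))"
    unfolding XY
  proof (rule distr_distr)
    show "(\<lambda>(x, y). (f x, g y)) \<in> PiM J M' \<Otimes>\<^sub>M PiM K M' \<rightarrow>\<^sub>M N \<Otimes>\<^sub>M L"
      unfolding case_prod_unfold
      by (intro measurable_Pair measurable_compose[OF measurable_fst f] measurable_compose[OF measurable_snd g])
  qed (intro measurable_Pair X Y)
  finally show ?thesis by (simp add: o_def X_def Y_def)
qed

text \<open>Injectivity of the order passes to both subtrees. Independence is used twice at a node:
  between the subtrees, and between the root angle and the pair of their values.\<close>

lemma (in prob_space) distr_tree_val:
  fixes Z :: "nat + nat \<Rightarrow> 'a \<Rightarrow> real"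
  assumes indep: "indep_vars (\<lambda>_. borel) Z UNIV"
    and Inl: "\<And>i. distr M borel (Z (Inl i)) = angle_law"
    and Inr: "\<And>i. distr M borel (Z (Inr i)) = \<mu>"
    and "inj_on ord (nodes \<gamma>)"
  shows "distr M borel (\<lambda>\<omega>. tree_val \<gamma> ord k (\<lambda>i. Z i \<omega>)) = tree_law \<mu> \<gamma>"
  using \<open>inj_on ord (nodes \<gamma>)\<close>
proof (induction \<gamma> arbitrary: ord k)
  case Leaf
  show ?case by (simp add: Inr)
next
  case (Node l r)
  define ord_l where "ord_l = (\<lambda>p. ord (LeftChild # p))"
  define ord_r where "ord_r = (\<lambda>p. ord (RightChild # p))"
  define Jl where "Jl = tree_coords l ord_l k"
  define Jr where "Jr = tree_coords r ord_r (k + leaves l)"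
  define X where "X \<omega> = tree_val l ord_l k (\<lambda>i. Z i \<omega>)" for \<omega>
  define Y where "Y \<omega> = tree_val r ord_r (k + leaves l) (\<lambda>i. Z i \<omega>)" for \<omega>
  define T where "T = Z (Inl (ord []))"
  have ord_eq: "ord p = ord q \<longleftrightarrow> p = q" if "p \<in> nodes (Node l r)" "q \<in> nodes (Node l r)" for p q
    using Node.prems that by (rule inj_on_eq_iff)
  have inj: "inj_on ord_l (nodes l)" "inj_on ord_r (nodes r)"
    by (auto intro!: inj_onI simp: ord_l_def ord_r_def ord_eq)
  have disj: "Jl \<inter> Jr = {}"
    by (auto simp: Jl_def Jr_def ord_l_def ord_r_def ord_eq)
  have root: "{Inl (ord [])} \<inter> (Jl \<union> Jr) = {}"
    by (auto simp: Jl_def Jr_def ord_l_def ord_r_def ord_eq)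
  have val_restrict: "tree_val l ord_l k (restrict z J) = tree_val l ord_l k z" if "Jl \<subseteq> J" for z J
    using that by (intro tree_val_cong) (auto simp: Jl_def)
  have val_restrict': "tree_val r ord_r (k + leaves l) (restrict z J) = tree_val r ord_r (k + leaves l) z"
    if "Jr \<subseteq> J" for z J
    using that by (intro tree_val_cong) (auto simp: Jr_def)
  have coords: "Jl \<subseteq> Jl" "Jr \<subseteq> Jr" "Jl \<subseteq> Jl \<union> Jr" "Jr \<subseteq> Jl \<union> Jr" by auto
  have meas: "tree_val l ord_l k \<in> (\<Pi>\<^sub>M i\<in>J. borel) \<rightarrow>\<^sub>M borel" if "Jl \<subseteq> J" for J
    using that unfolding Jl_def by (rule measurable_tree_val)
  have meas': "tree_val r ord_r (k + leaves l) \<in> (\<Pi>\<^sub>M i\<in>J. borel) \<rightarrow>\<^sub>M borel" if "Jr \<subseteq> J" for J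
    using that unfolding Jr_def by (rule measurable_tree_val)
  have XY: "distr M borel X \<Otimes>\<^sub>M distr M borel Y = distr M (borel \<Otimes>\<^sub>M borel) (\<lambda>\<omega>. (X \<omega>, Y \<omega>))"
    using distr_disjoint_coords[OF indep disj meas[OF coords(1)] meas'[OF coords(2)]]
    by (simp only: val_restrict[OF coords(1)] val_restrict'[OF coords(2)] X_def[abs_def] Y_def[abs_def])
  have "(\<lambda>z. z (Inl (ord []))) \<in> (\<Pi>\<^sub>M i\<in>{Inl (ord [])}. borel) \<rightarrow>\<^sub>M borel"
    by (rule measurable_component_singleton) simp
  from distr_disjoint_coords[OF indep root this measurable_Pair[OF meas[OF coords(3)] meas'[OF coords(4)]]]
  have TXY: "distr M borel T \<Otimes>\<^sub>M distr M (borel \<Otimes>\<^sub>M borel) (\<lambda>\<omega>. (X \<omega>, Y \<omega>)) =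
      distr M (borel \<Otimes>\<^sub>M (borel \<Otimes>\<^sub>M borel)) (\<lambda>\<omega>. (T \<omega>, X \<omega>, Y \<omega>))"
    by (simp add: val_restrict[OF coords(3)] val_restrict'[OF coords(4)] X_def Y_def T_def)
  have Z_meas: "Z i \<in> borel_measurable M" for i
    using indep by (simp add: indep_vars_def)
  have Z: "(\<lambda>\<omega> i. Z i \<omega>) \<in> M \<rightarrow>\<^sub>M (\<Pi>\<^sub>M i\<in>UNIV. borel)"
    by (intro measurable_PiM_single') (use Z_meas in auto)
  have [measurable]: "T \<in> borel_measurable M" "X \<in> borel_measurable M" "Y \<in> borel_measurable M"
    unfolding T_def X_def[abs_def] Y_def[abs_def]
    by (rule Z_meas measurable_compose[OF Z measurable_tree_val[OF subset_UNIV]])+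
  have "tree_law \<mu> (Node l r) = distr (distr M borel T \<Otimes>\<^sub>M (distr M borel X \<Otimes>\<^sub>M distr M borel Y)) borel
      (\<lambda>(\<theta>, x, y). cos \<theta> * x + sin \<theta> * y)"
    using Node.IH(1)[OF inj(1)] Node.IH(2)[OF inj(2)]
    by (simp add: Inl T_def X_def[abs_def] Y_def[abs_def])
  also have "\<dots> = distr M borel ((\<lambda>(\<theta>, x, y). cos \<theta> * x + sin \<theta> * y) \<circ> (\<lambda>\<omega>. (T \<omega>, X \<omega>, Y \<omega>)))"
    unfolding XY TXY by (intro distr_distr) measurable
  finally show ?case
    by (simp add: o_def T_def X_def Y_def ord_l_def ord_r_def)
qed

text \<open>This supplies the hypotheses of \<open>distr_tree_val\<close> on the product space.
  Independence follows by comparing the joint law of all coordinates with the product of their laws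
  on cylinders.\<close>

lemma
  assumes \<mu>: "real_distribution \<mu>"
  defines "Z \<equiv> case_sum (\<lambda>i \<omega>. fst \<omega> i) (\<lambda>j \<omega>. snd \<omega> j) :: nat + nat \<Rightarrow> (nat \<Rightarrow> real) \<times> (nat \<Rightarrow> real) \<Rightarrow> real"
  shows distr_angle_coord: "distr (angle_seq \<Otimes>\<^sub>M iid_seq \<mu>) borel (Z (Inl i)) = angle_law"
    and distr_leaf_coord: "distr (angle_seq \<Otimes>\<^sub>M iid_seq \<mu>) borel (Z (Inr j)) = \<mu>"
    and indep_vars_coords: "prob_space.indep_vars (angle_seq \<Otimes>\<^sub>M iid_seq \<mu>) (\<lambda>_. borel) Z UNIV"
proof -
  interpret \<mu>: real_distribution \<mu> by (rule \<mu>)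
  interpret angles: prob_space angle_seq by (intro prob_space_PiM prob_space_uniform_angle)
  interpret iid: prob_space "iid_seq \<mu>" by (intro prob_space_PiM \<mu>.prob_space_axioms)
  interpret pair: pair_prob_space angle_seq "iid_seq \<mu>" ..
  let ?M = "angle_seq \<Otimes>\<^sub>M iid_seq \<mu>"
  \<comment> \<open>The angles first keep their own space; the laws and independence are transported
    to the Borel sets of the line by the identity map afterwards.\<close>
  define N :: "nat + nat \<Rightarrow> real measure" where "N = case_sum (\<lambda>_. uniform_angle) (\<lambda>_. \<mu>)"
  have N [simp]: "N (Inl i) = uniform_angle" "N (Inr j) = \<mu>" for i j
    by (simp_all add: N_def)
  have N_borel: "(\<lambda>x. x) \<in> N i \<rightarrow>\<^sub>M borel" for i
    by (cases i) (simp_all add: measurable_uniform_angle)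
  have prob_N: "prob_space (N i)" for i
    by (cases i) (simp_all add: prob_space_uniform_angle \<mu>.prob_space_axioms)
  have Z_meas [measurable]: "Z i \<in> ?M \<rightarrow>\<^sub>M N i" for i
    unfolding Z_def by (cases i) (simp_all add: measurable_compose[OF measurable_fst] measurable_compose[OF measurable_snd])
  have distr_Inl: "distr ?M uniform_angle (Z (Inl i)) = uniform_angle" for i
  proof -
    have "distr ?M uniform_angle (Z (Inl i)) = distr (distr ?M angle_seq fst) uniform_angle (\<lambda>\<omega>. \<omega> i)"
      by (subst distr_distr) (simp_all add: Z_def o_def)
    then show ?thesis
      by (simp add: iid.distr_pair_fst prob_space_uniform_angle
          distr_PiM_component[of UNIV "\<lambda>_. uniform_angle" i])
  qed
  have distr_Inr: "distr ?M \<mu> (Z (Inr j)) = \<mu>" for j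
  proof -
    have "distr ?M (iid_seq \<mu>) snd = iid_seq \<mu>"
      by (subst pair.distr_pair_swap)
        (simp add: distr_distr o_def case_prod_unfold angles.distr_pair_fst)
    moreover have "distr ?M \<mu> (Z (Inr j)) = distr (distr ?M (iid_seq \<mu>) snd) \<mu> (\<lambda>\<omega>. \<omega> j)"
      by (subst distr_distr) (simp_all add: Z_def o_def)
    ultimately show ?thesis
      by (simp add: distr_PiM_component[of UNIV "\<lambda>_. \<mu>" j] \<mu>.prob_space_axioms)
  qed
  have distr_N: "distr ?M (N i) (Z i) = N i" for i
    by (cases i) (simp_all add: distr_Inl distr_Inr)
  have distr_borel: "distr ?M borel (Z i) = distr (N i) borel (\<lambda>x. x)" for i
  proof -
    have "distr (distr ?M (N i) (Z i)) borel (\<lambda>x. x) = distr ?M borel (Z i)"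
      by (simp add: distr_distr[OF N_borel Z_meas] o_def)
    then show ?thesis by (simp add: distr_N)
  qed
  show "distr ?M borel (Z (Inl i)) = angle_law"
    unfolding distr_borel by (simp add: distr_uniform_angle)
  show "distr ?M borel (Z (Inr j)) = \<mu>"
    unfolding distr_borel by (simp add: distr_id2)
  have "distr ?M (Pi\<^sub>M UNIV N) (\<lambda>\<omega>. \<lambda>i\<in>UNIV. Z i \<omega>) = Pi\<^sub>M UNIV N"
  proof (rule measure_eqI_PiM_infinite)
    show "finite_measure (distr ?M (Pi\<^sub>M UNIV N) (\<lambda>\<omega>. \<lambda>i\<in>UNIV. Z i \<omega>))"
      by (intro prob_space.finite_measure pair.prob_space_distr) measurable
    fix A :: "nat + nat \<Rightarrow> real set" and J :: "(nat + nat) set"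
    assume J: "finite J" and A: "\<And>i. i \<in> J \<Longrightarrow> A i \<in> sets (N i)"
    \<comment> \<open>A finite set of coordinates splits into angles and leaves, so its cylinder is
      a rectangle in the pair space and its measure factors.\<close>
    define Jl where "Jl = Inl -` J"
    define Jr where "Jr = Inr -` J"
    have fin: "finite Jl" "finite Jr"
      using J by (auto simp: Jl_def Jr_def intro!: finite_vimageI)
    have J_eq: "J = Inl ` Jl \<union> Inr ` Jr"
      using UNIV_sum by (auto simp: Jl_def Jr_def)
    have A': "i \<in> Jl \<Longrightarrow> A (Inl i) \<in> sets uniform_angle" "j \<in> Jr \<Longrightarrow> A (Inr j) \<in> sets \<mu>" for i j
      using A[of "Inl i"] A[of "Inr j"] by (auto simp: Jl_def Jr_def)
    let ?El = "prod_emb UNIV (\<lambda>_. uniform_angle) Jl (\<Pi>\<^sub>E i\<in>Jl. A (Inl i))"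
    let ?Er = "prod_emb UNIV (\<lambda>_. \<mu>) Jr (\<Pi>\<^sub>E j\<in>Jr. A (Inr j))"
    have sets_El: "?El \<in> sets angle_seq"
      by (rule sets_PiM_I) (simp_all add: fin A')
    have sets_Er: "?Er \<in> sets (iid_seq \<mu>)"
      by (rule sets_PiM_I) (simp_all add: fin A' del: \<mu>.events_eq_borel)
    have "(\<lambda>\<omega>. \<lambda>i\<in>UNIV. Z i \<omega>) -` prod_emb UNIV N J (Pi\<^sub>E J A) \<inter> space ?M = ?El \<times> ?Er"
      unfolding J_eq by (auto simp: prod_emb_def space_pair_measure space_PiM Z_def PiE_iff ball_Un split_sum_all)
    moreover have "prod_emb UNIV N J (Pi\<^sub>E J A) \<in> sets (Pi\<^sub>M UNIV N)"
      using J A by (intro sets_PiM_I) auto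
    ultimately have "emeasure (distr ?M (Pi\<^sub>M UNIV N) (\<lambda>\<omega>. \<lambda>i\<in>UNIV. Z i \<omega>)) (prod_emb UNIV N J (Pi\<^sub>E J A)) =
        emeasure angle_seq ?El * emeasure (iid_seq \<mu>) ?Er"
      by (simp add: emeasure_distr iid.emeasure_pair_measure_Times sets_El sets_Er)
    also have "\<dots> = (\<Prod>i\<in>Jl. emeasure uniform_angle (A (Inl i))) * (\<Prod>j\<in>Jr. emeasure \<mu> (A (Inr j)))"
      using fin A' by (simp add: emeasure_PiM_emb prob_space_uniform_angle \<mu>.prob_space_axioms)
    also have "\<dots> = (\<Prod>i\<in>J. emeasure (N i) (A i))"
      unfolding J_eq using fin
      by (subst prod.union_disjoint) (auto simp: prod.reindex)
    also have "\<dots> = emeasure (Pi\<^sub>M UNIV N) (prod_emb UNIV N J (Pi\<^sub>E J A))"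
      using J A by (simp add: emeasure_PiM_emb prob_N)
    finally show "emeasure (distr ?M (Pi\<^sub>M UNIV N) (\<lambda>\<omega>. \<lambda>i\<in>UNIV. Z i \<omega>)) (prod_emb UNIV N J (Pi\<^sub>E J A)) =
        emeasure (Pi\<^sub>M UNIV N) (prod_emb UNIV N J (Pi\<^sub>E J A))" .
  qed simp_all
  then have "pair.indep_vars N Z UNIV"
    by (subst pair.indep_vars_iff_distr_eq_PiM) (simp_all add: distr_N)
  then show "pair.indep_vars (\<lambda>_. borel) Z UNIV"
    by (rule pair.indep_vars_compose2[where Y = "\<lambda>_ x. x"]) (rule N_borel)
qed

section \<open>The random tree\<close>

text \<open>The index is shifted by one leaf to fit \<open>geometric_pmf\<close>, whose values start
  at 0.\<close>

definition tree_pmf :: "nat \<Rightarrow> mckean pmf" where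
  "tree_pmf n = embed_pmf (\<lambda>\<gamma>. if \<gamma> \<in> G (Suc n) then tree_prob \<gamma> else 0)"

lemma pmf_tree_pmf: "pmf (tree_pmf n) \<gamma> = (if \<gamma> \<in> G (Suc n) then tree_prob \<gamma> else 0)"
  unfolding tree_pmf_def
proof (rule pmf_embed_pmf)
  have "(\<integral>\<^sup>+\<gamma>. ennreal (if \<gamma> \<in> G (Suc n) then tree_prob \<gamma> else 0) \<partial>count_space UNIV) =
      (\<Sum>\<gamma>\<in>G (Suc n). ennreal (if \<gamma> \<in> G (Suc n) then tree_prob \<gamma> else 0))"
    by (rule nn_integral_count_space'[OF finite_G]) auto
  also have "\<dots> = ennreal (\<Sum>\<gamma>\<in>G (Suc n). tree_prob \<gamma>)"
    by (simp add: tree_prob_nonneg)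
  finally show "(\<integral>\<^sup>+\<gamma>. ennreal (if \<gamma> \<in> G (Suc n) then tree_prob \<gamma> else 0) \<partial>count_space UNIV) = 1"
    by (simp add: sum_tree_prob)
qed (simp add: tree_prob_nonneg)

definition wild_tree_pmf :: "real \<Rightarrow> mckean pmf" where
  "wild_tree_pmf t = bind_pmf (geometric_pmf (exp (-t))) tree_pmf"

lemma pmf_geometric_wild_weight:
  assumes "0 < t"
  shows "pmf (geometric_pmf (exp (-t))) n = wild_weight t (Suc n)"
  using assms by (simp add: wild_weight_def)

lemma pmf_wild_tree_pmf:
  assumes "0 < t"
  shows "pmf (wild_tree_pmf t) \<gamma> = wild_weight t (leaves \<gamma>) * tree_prob \<gamma>"
proof -
  obtain n where n: "leaves \<gamma> = Suc n"
    using leaves_pos[of \<gamma>] by (metis gr0_implies_Suc)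
  have "pmf (wild_tree_pmf t) \<gamma> =
      (\<integral>m. pmf (tree_pmf m) \<gamma> \<partial>geometric_pmf (exp (-t)))"
    by (simp add: wild_tree_pmf_def pmf_bind)
  also have "\<dots> = (\<Sum>m\<in>{n}. pmf (tree_pmf m) \<gamma> * pmf (geometric_pmf (exp (-t))) m)"
    by (rule integral_measure_pmf_real) (auto simp: pmf_tree_pmf G_def n split: if_splits)
  finally show ?thesis
    by (simp add: pmf_geometric_wild_weight[OF assms] pmf_tree_pmf G_def n)
qed

text \<open>The tower property of conditional expectation, reduced to real and imaginary parts; the
  bound makes all integrals finite.\<close>

lemma integral_bind_pmf_complex:
  fixes f :: "'a \<Rightarrow> complex"
  assumes bound: "\<And>x. norm (f x) \<le> B"
  shows "(\<integral>x. f x \<partial>bind_pmf p q) = (\<integral>y. (\<integral>x. f x \<partial>q y) \<partial>p)"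
proof -
  have int: "integrable (measure_pmf r) f" for r
    using bound by (intro measure_pmf.integrable_const_bound[where B = B]) auto
  have "norm (\<integral>x. f x \<partial>q y) \<le> B" for y
  proof -
    have "(\<integral>x. norm (f x) \<partial>q y) \<le> B"
      using int bound by (intro measure_pmf.integral_le_const) auto
    with integral_norm_bound[of "q y" f] show ?thesis by linarith
  qed
  then have int': "integrable (measure_pmf p) (\<lambda>y. \<integral>x. f x \<partial>q y)"
    by (intro measure_pmf.integrable_const_bound[where B = B]) auto
  have real: "(\<integral>x. g x \<partial>bind_pmf p q) = (\<integral>y. (\<integral>x. g x \<partial>q y) \<partial>p)"
    if "\<And>x. \<bar>g x\<bar> \<le> B" for g :: "'a \<Rightarrow> real"
    unfolding measure_pmf_bind
    by (rule integral_bind[where K = "count_space UNIV" and B = B and B' = 1])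
       (use that measurable_measure_pmf[of q] in \<open>auto simp: measure_pmf.finite_measure_axioms\<close>)
  show ?thesis
  proof (rule complex_eqI)
    show "Re (\<integral>x. f x \<partial>bind_pmf p q) = Re (\<integral>y. (\<integral>x. f x \<partial>q y) \<partial>p)"
      using real[of "\<lambda>x. Re (f x)"] order_trans[OF abs_Re_le_cmod bound] by (simp add: int int')
    show "Im (\<integral>x. f x \<partial>bind_pmf p q) = Im (\<integral>y. (\<integral>x. f x \<partial>q y) \<partial>p)"
      using real[of "\<lambda>x. Im (f x)"] order_trans[OF abs_Im_le_cmod bound] by (simp add: int int')
  qed
qed

text \<open>Conditioning on the number of leaves turns the average over trees into
  \<open>wild_coeff\<close>, and the geometric weights then reproduce the Wild series.\<close>

lemma integral_wild_tree_pmf: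
  fixes \<mu> :: "real measure"
  assumes \<mu>: "real_distribution \<mu>" and t: "0 < t"
  shows "(\<integral>\<gamma>. char (tree_law \<mu> \<gamma>) \<xi> \<partial>wild_tree_pmf t) = wild_coefficients.wild (wild_coeff \<mu>) t \<xi>"
proof -
  interpret wild_coefficients "wild_coeff \<mu>" by (rule wild_coefficients_wild_coeff[OF \<mu>])
  have bound: "norm (char (tree_law \<mu> \<gamma>) \<xi>) \<le> 1" for \<gamma>
    by (rule real_distribution.cmod_char_le_1[OF real_distribution_tree_law[OF \<mu>]])
  have "(\<integral>\<gamma>. char (tree_law \<mu> \<gamma>) \<xi> \<partial>tree_pmf n) = wild_coeff \<mu> n \<xi>" for n
    unfolding wild_coeff_def
    by (subst integral_measure_pmf[of "G (Suc n)"]) (auto simp: set_pmf_iff pmf_tree_pmf finite_G split: if_splits)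
  then have "(\<integral>\<gamma>. char (tree_law \<mu> \<gamma>) \<xi> \<partial>wild_tree_pmf t) =
      (\<integral>n. wild_coeff \<mu> n \<xi> \<partial>geometric_pmf (exp (-t)))"
    unfolding wild_tree_pmf_def by (simp add: integral_bind_pmf_complex[OF bound])
  also have "\<dots> = (\<integral>n. pmf (geometric_pmf (exp (-t))) n *\<^sub>R wild_coeff \<mu> n \<xi> \<partial>count_space UNIV)"
    unfolding measure_pmf_eq_density by (subst integral_density) auto
  also have "\<dots> = (\<Sum>n. pmf (geometric_pmf (exp (-t))) n *\<^sub>R wild_coeff \<mu> n \<xi>)"
  proof (rule integral_count_space_nat)
    have "integrable (geometric_pmf (exp (-t))) (\<lambda>n. wild_coeff \<mu> n \<xi>)"
      using norm_c_le by (intro measure_pmf.integrable_const_bound[where B = 1]) auto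
    then show "integrable (count_space UNIV) (\<lambda>n. pmf (geometric_pmf (exp (-t))) n *\<^sub>R wild_coeff \<mu> n \<xi>)"
      unfolding measure_pmf_eq_density by (subst (asm) integrable_density) auto
  qed
  also have "\<dots> = (\<Sum>n. of_real (exp (-t)) * (wild_coeff \<mu> n \<xi> * of_real (1 - exp (-t)) ^ n))"
    using t by (simp add: scaleR_conv_of_real mult_ac)
  also have "\<dots> = wild t \<xi>"
  proof -
    have "norm (complex_of_real (1 - exp (-t))) < 1"
      using t by (subst norm_of_real) simp
    then show ?thesis
      unfolding wild_def gen_def
      by (intro suminf_mult summable_norm_cancel[OF summable_norm_gen])
  qed
  finally show ?thesis .
qed

theorem theorem3:
  fixes \<mu>\<^sub>0 :: "real measure"
    and \<phi> :: "real \<Rightarrow> real \<Rightarrow> complex"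
    and \<mu> :: "real \<Rightarrow> real measure"
    and ord :: "mckean \<Rightarrow> child list \<Rightarrow> nat"
    and t :: real
  assumes "real_distribution \<mu>\<^sub>0"
    and "kac_solution (char \<mu>\<^sub>0) \<phi>"
    and "\<And>s. s \<ge> 0 \<Longrightarrow> real_distribution (\<mu> s)"
    and "\<And>s \<xi>. s \<ge> 0 \<Longrightarrow> char (\<mu> s) \<xi> = \<phi> \<xi> s"
    and "node_order ord"
    and "t > 0"
  shows "\<exists>(P :: (nat \<times> mckean \<times> (nat \<Rightarrow> real) \<times> (nat \<Rightarrow> real)) measure) \<nu> \<gamma> \<theta> x.
    prob_space P \<and>
    \<nu> \<in> P \<rightarrow>\<^sub>M count_space {1..} \<and>
    \<gamma> \<in> P \<rightarrow>\<^sub>M count_space UNIV \<and>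
    \<theta> \<in> P \<rightarrow>\<^sub>M angle_seq \<and>
    x \<in> P \<rightarrow>\<^sub>M iid_seq \<mu>\<^sub>0 \<and>
    (\<forall>n\<ge>1. \<forall>g. \<forall>A \<in> sets angle_seq. \<forall>B \<in> sets (iid_seq \<mu>\<^sub>0).
      measure P {\<omega> \<in> space P. \<nu> \<omega> = n \<and> \<gamma> \<omega> = g \<and> \<theta> \<omega> \<in> A \<and> x \<omega> \<in> B} =
        wild_weight t n * tree_prob g * indicator (G n) g *
        measure angle_seq A * measure (iid_seq \<mu>\<^sub>0) B) \<and>
    (\<lambda>\<omega>. \<Sum>j<\<nu> \<omega>. leaf_coeff ord j (\<gamma> \<omega>) (\<theta> \<omega>) * x \<omega> j) \<in> borel_measurable P \<and>
    distr P borel (\<lambda>\<omega>. \<Sum>j<\<nu> \<omega>. leaf_coeff ord j (\<gamma> \<omega>) (\<theta> \<omega>) * x \<omega> j) = \<mu> t"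
proof -
  interpret \<mu>\<^sub>0: real_distribution \<mu>\<^sub>0 by fact
  interpret angles: prob_space angle_seq by (intro prob_space_PiM prob_space_uniform_angle)
  interpret iid: prob_space "iid_seq \<mu>\<^sub>0" by (intro prob_space_PiM \<mu>\<^sub>0.prob_space_axioms)
  let ?W = "angle_seq \<Otimes>\<^sub>M iid_seq \<mu>\<^sub>0"
  interpret W: pair_prob_space angle_seq "iid_seq \<mu>\<^sub>0" ..
  define T where "T = wild_tree_pmf t"
  interpret TW: pair_prob_space "measure_pmf T" ?W ..
  interpret wild_coefficients "wild_coeff \<mu>\<^sub>0"
    by (rule wild_coefficients_wild_coeff) fact
  \<comment> \<open>The number of leaves is a function of the tree, so only the tree and the two
    sequences are drawn independently, and the triple is completed by its leaf count.\<close>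
  define P where "P = distr (measure_pmf T \<Otimes>\<^sub>M ?W)
    (count_space UNIV \<Otimes>\<^sub>M count_space UNIV \<Otimes>\<^sub>M ?W) (\<lambda>(\<gamma>, w). (leaves \<gamma>, \<gamma>, w))"
  \<comment> \<open>Reading the count off the tree rather than off the first component makes it
    positive and consistent with the tree at every point, not just almost surely.\<close>
  define \<nu> :: "nat \<times> mckean \<times> (nat \<Rightarrow> real) \<times> (nat \<Rightarrow> real) \<Rightarrow> nat"
    where "\<nu> \<omega> = leaves (fst (snd \<omega>))" for \<omega>
  define \<gamma> :: "nat \<times> mckean \<times> (nat \<Rightarrow> real) \<times> (nat \<Rightarrow> real) \<Rightarrow> mckean"
    where "\<gamma> \<omega> = fst (snd \<omega>)" for \<omega>
  define \<theta> :: "nat \<times> mckean \<times> (nat \<Rightarrow> real) \<times> (nat \<Rightarrow> real) \<Rightarrow> nat \<Rightarrow> real"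
    where "\<theta> \<omega> = fst (snd (snd \<omega>))" for \<omega>
  define x :: "nat \<times> mckean \<times> (nat \<Rightarrow> real) \<times> (nat \<Rightarrow> real) \<Rightarrow> nat \<Rightarrow> real"
    where "x \<omega> = snd (snd (snd \<omega>))" for \<omega>
  define U where "U g w = tree_val g (ord g) 0 (case_sum (fst w) (snd w))"
    for g and w :: "(nat \<Rightarrow> real) \<times> (nat \<Rightarrow> real)"
  define V where "V \<omega> = (\<Sum>j<\<nu> \<omega>. leaf_coeff ord j (\<gamma> \<omega>) (\<theta> \<omega>) * x \<omega> j)" for \<omega>
  let ?Z = "case_sum (\<lambda>i \<omega>. fst \<omega> i) (\<lambda>j \<omega>. snd \<omega> j) ::
    nat + nat \<Rightarrow> (nat \<Rightarrow> real) \<times> (nat \<Rightarrow> real) \<Rightarrow> real"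
  have embed: "(\<lambda>(\<gamma>, w). (leaves \<gamma>, \<gamma>, w)) \<in>
      measure_pmf T \<Otimes>\<^sub>M ?W \<rightarrow>\<^sub>M count_space UNIV \<Otimes>\<^sub>M count_space UNIV \<Otimes>\<^sub>M ?W"
    unfolding case_prod_unfold
    by (intro measurable_Pair measurable_snd measurable_compose[OF measurable_fst, of leaves]
        measurable_compose[OF measurable_fst, of "\<lambda>g. g"]) auto
  have sets_P [measurable_cong]: "sets P = sets (count_space UNIV \<Otimes>\<^sub>M count_space UNIV \<Otimes>\<^sub>M ?W)"
    by (simp add: P_def)
  have rvs [measurable]: "\<gamma> \<in> P \<rightarrow>\<^sub>M count_space UNIV" "\<theta> \<in> P \<rightarrow>\<^sub>M angle_seq" "x \<in> P \<rightarrow>\<^sub>M iid_seq \<mu>\<^sub>0"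
    unfolding \<gamma>_def[abs_def] \<theta>_def[abs_def] x_def[abs_def] by measurable
  have prob: "prob_space P"
    unfolding P_def by (rule TW.prob_space_distr[OF embed])
  have \<nu>: "\<nu> \<in> P \<rightarrow>\<^sub>M count_space {1..}"
    unfolding \<nu>_def[abs_def] \<gamma>_def[symmetric]
    by (rule measurable_compose[of \<gamma> P "count_space UNIV"]) (use leaves_pos in \<open>auto simp: Suc_le_eq\<close>)
  have joint: "measure P {\<omega> \<in> space P. \<nu> \<omega> = n \<and> \<gamma> \<omega> = g \<and> \<theta> \<omega> \<in> A \<and> x \<omega> \<in> B} =
        wild_weight t n * tree_prob g * indicator (G n) g *
        measure angle_seq A * measure (iid_seq \<mu>\<^sub>0) B"
    if A: "A \<in> sets angle_seq" and B: "B \<in> sets (iid_seq \<mu>\<^sub>0)" for n g A B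
  \<comment> \<open>If \<open>g\<close> does not have \<open>n\<close> leaves, the event is empty
    and the indicator vanishes. Otherwise the condition on the count follows from the one on the
    tree, and the event is a rectangle.\<close>
  proof (cases "leaves g = n")
    case True
    have AB: "A \<times> B \<in> sets ?W" using A B by simp
    have "{\<omega> \<in> space P. \<nu> \<omega> = n \<and> \<gamma> \<omega> = g \<and> \<theta> \<omega> \<in> A \<and> x \<omega> \<in> B} = UNIV \<times> {g} \<times> A \<times> B"
      using True sets.sets_into_space[OF A] sets.sets_into_space[OF B]
      by (auto simp: P_def space_pair_measure \<nu>_def \<gamma>_def \<theta>_def x_def)
    moreover have "measure P (UNIV \<times> {g} \<times> A \<times> B) = measure (measure_pmf T \<Otimes>\<^sub>M ?W) ({g} \<times> A \<times> B)"
    proof -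
      have "(\<lambda>(\<gamma>, w). (leaves \<gamma>, \<gamma>, w)) -` (UNIV \<times> {g} \<times> A \<times> B) \<inter> space (measure_pmf T \<Otimes>\<^sub>M ?W) = {g} \<times> A \<times> B"
        using sets.sets_into_space[OF AB] by (auto simp: space_pair_measure)
      then show ?thesis
        unfolding P_def by (subst measure_distr[OF embed]) (use AB in simp_all)
    qed
    moreover have "\<dots> = measure T {g} * (measure angle_seq A * measure (iid_seq \<mu>\<^sub>0) B)"
      using A B AB by (simp add: measure_def W.P.emeasure_pair_measure_Times
        iid.emeasure_pair_measure_Times enn2real_mult)
    ultimately show ?thesis
      using True \<open>t > 0\<close>
      by (simp add: T_def measure_pmf_single pmf_wild_tree_pmf G_def)
  next
    case False
    then have "{\<omega> \<in> space P. \<nu> \<omega> = n \<and> \<gamma> \<omega> = g \<and> \<theta> \<omega> \<in> A \<and> x \<omega> \<in> B} = {}"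
      by (auto simp: \<nu>_def \<gamma>_def)
    with False show ?thesis by (simp only: G_def) simp
  qed
  have V: "V \<omega> = U (fst (snd \<omega>)) (snd (snd \<omega>))" for \<omega>
    by (simp add: V_def U_def \<nu>_def \<gamma>_def \<theta>_def x_def sum_leaf_coeff)
  have coords: "case_sum (fst w) (snd w) = (\<lambda>i. ?Z i w)" for w
    by (auto simp: fun_eq_iff split: sum.split)
  have U_law: "distr ?W borel (U g) = tree_law \<mu>\<^sub>0 g" for g
    unfolding U_def coords
    using \<open>node_order ord\<close> distr_angle_coord[OF \<open>real_distribution \<mu>\<^sub>0\<close>]
      distr_leaf_coord[OF \<open>real_distribution \<mu>\<^sub>0\<close>] indep_vars_coords[OF \<open>real_distribution \<mu>\<^sub>0\<close>]
    by (intro W.distr_tree_val) (auto simp: node_order_def bij_betw_def)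
  have Z_meas: "(\<lambda>w. ?Z i w) \<in> borel_measurable ?W" for i
    using indep_vars_coords[OF \<open>real_distribution \<mu>\<^sub>0\<close>] by (simp add: W.indep_vars_def)
  have U_meas [measurable]: "U g \<in> borel_measurable ?W" for g
  proof -
    have "(\<lambda>w i. ?Z i w) \<in> ?W \<rightarrow>\<^sub>M (\<Pi>\<^sub>M i\<in>UNIV. borel)"
      by (intro measurable_PiM_single') (use Z_meas in auto)
    from measurable_compose[OF this measurable_tree_val[OF subset_UNIV]] show ?thesis
      unfolding U_def coords .
  qed
  \<comment> \<open>There are only countably many trees, so measurability for each fixed tree gives
    joint measurability.\<close>
  have U_meas': "(\<lambda>y. U (f y) (h y)) \<in> borel_measurable M"
    if "f \<in> M \<rightarrow>\<^sub>M count_space UNIV" "h \<in> M \<rightarrow>\<^sub>M ?W" for f h and M :: "'z measure"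
    using that by (intro measurable_compose_countable'[where f = "\<lambda>g y. U g (h y)" and g = f and I = UNIV]
        countable_trees measurable_compose[OF _ U_meas])
  have V_meas [measurable]: "V \<in> borel_measurable P"
    unfolding V[abs_def] by (intro U_meas') measurable
  have V_law: "distr P borel V = \<mu> t"
  proof (rule Levy_uniqueness)
    show "real_distribution (distr P borel V)"
      using prob by (intro prob_space.real_distribution_distr) measurable
    show "real_distribution (\<mu> t)"
      using assms(3) \<open>t > 0\<close> by simp
    show "char (distr P borel V) = char (\<mu> t)"
    proof
      fix \<xi>
      have U_pair [measurable]: "(\<lambda>y. U (fst y) (snd y)) \<in> borel_measurable (measure_pmf T \<Otimes>\<^sub>M ?W)"
        by (intro U_meas') measurable
      have "char (distr P borel V) \<xi> = (\<integral>y. iexp (\<xi> * U (fst y) (snd y)) \<partial>(measure_pmf T \<Otimes>\<^sub>M ?W))"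
      proof -
        have "distr P borel V = distr (measure_pmf T \<Otimes>\<^sub>M ?W) borel (\<lambda>y. U (fst y) (snd y))"
          unfolding P_def using V_meas
          by (subst distr_distr[OF _ embed]) (simp_all add: P_def V o_def case_prod_unfold)
        then show ?thesis
          unfolding char_def by (simp add: integral_distr)
      qed
      \<comment> \<open>Fubini conditions on the tree; the inner integral is then the characteristic
        function of \<open>tree_law\<close>.\<close>
      also have "\<dots> = (\<integral>g. (\<integral>w. iexp (\<xi> * U g w) \<partial>?W) \<partial>T)"
        by (subst TW.integral_fst'[symmetric]) (auto intro!: TW.integrable_const_bound[where B = 1])
      also have "\<dots> = (\<integral>g. char (tree_law \<mu>\<^sub>0 g) \<xi> \<partial>T)"
        unfolding char_def U_law[symmetric] by (subst integral_distr) auto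
      also have "\<dots> = wild t \<xi>"
        unfolding T_def by (rule integral_wild_tree_pmf) fact+
      also have "\<dots> = \<phi> \<xi> t"
      \<comment> \<open>At each time the given solution is a characteristic function, hence
        measurable and bounded by 1, as the uniqueness argument requires.\<close>
      proof (rule kac_solution_eq_wild[symmetric])
        show "kac_solution (wild_coeff \<mu>\<^sub>0 0) \<phi>"
          using assms(2) by (simp add: wild_coeff_0)
        show "(\<lambda>\<xi>. \<phi> \<xi> s) \<in> borel_measurable borel" if "0 \<le> s" for s
          using real_distribution.char_measurable[OF assms(3)[OF that]] assms(4)[OF that]
          by (simp cong: measurable_cong)
        show "norm (\<phi> \<xi> s) \<le> 1" if "0 \<le> s" for s \<xi>
          using real_distribution.cmod_char_le_1[OF assms(3)[OF that]] assms(4)[OF that] by metis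
      qed (use \<open>t > 0\<close> in simp)
      finally show "char (distr P borel V) \<xi> = char (\<mu> t) \<xi>"
        using assms(4) \<open>t > 0\<close> by simp
    qed
  qed
  show ?thesis
    by (rule exI[of _ P], rule exI[of _ \<nu>], rule exI[of _ \<gamma>], rule exI[of _ \<theta>], rule exI[of _ x])
       (use prob \<nu> rvs joint V_meas[unfolded V_def[abs_def]] V_law[unfolded V_def[abs_def]] in
         \<open>intro conjI allI ballI impI; assumption?; blast\<close>)
qed

end
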